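(* Let $L$ be a finite relational language consisting of unary and binary relation symbols, and let $\mathbf{K}$ be a countably infinite irreducible $L$-structure. Assume that every countable $L$-structure $\mathbf{A}$ has a completion to $\mathbf{K}$ provided that every induced cycle in $\mathbf{A}$ (seen as a substructure of $\mathbf{A}$) has a completion to $\mathbf{K}$ and every irreducible substructure of $\mathbf{A}$ of size at most $2$ embeds into $\mathbf{K}$. Then $\mathbf{K}$ has finite big Ramsey degrees.
   Context: An $L$-structure $\mathbf{A}$ consists of a vertex set $A$ and a relation $R^{\mathbf{A}}\subseteq A^r$ for each symbol $R\in L$ of arity $r$. A homomorphism $f\colon\mathbf{A}\to\mathbf{B}$ is a map $A\to B$ with $(x_1,\dots,x_r)\in R^{\mathbf{A}}\Rightarrow (f(x_1),\dots,f(x_r))\in R^{\mathbf{B}}$ for all $R\in L$; it is an embedding if it is injective and the implication is an equivalence. Substructures are induced. Two distinct vertices $u,v$ of $\mathbf{A}$ are adjacent if $(u,v)\in R^{\mathbf{A}}$ or $(v,u)\in R^{\mathbf{A}}$ for some $R\in L$; $\mathbf{A}$ is irreducible if any two distinct vertices are adjacent. A cycle is a sequence $v_0,\dots,v_{\ell-1}$, $\ell\ge 3$, of distinct vertices with $v_i$ adjacent to $v_{i+1}$ for $0\le i\le \ell-2$ and $v_{\ell-1}$ adjacent to $v_0$; it is induced if no other pair of vertices in the sequence is adjacent. A homomorphism $f\colon\mathbf{A}\to\mathbf{B}$ is a homomorphism-embedding if its restriction to every irreducible substructure of $\mathbf{A}$ is an embedding; it is a completion of $\mathbf{A}$ to $\mathbf{B}$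 if moreover $f$ is injective and $\mathbf{B}$ is irreducible. For structures $\mathbf{A},\mathbf{B}$, $\binom{\mathbf{B}}{\mathbf{A}}$ denotes the set of embeddings $\mathbf{A}\to\mathbf{B}$. For a countably infinite $\mathbf{B}$ and finite substructure $\mathbf{A}$, the big Ramsey degree of $\mathbf{A}$ in $\mathbf{B}$ is the least $l\in\mathbb{N}\cup\{\infty\}$ such that for every $k\in\mathbb{N}$ and every colouring of $\binom{\mathbf{B}}{\mathbf{A}}$ with $k$ colours there is an embedding $f\colon\mathbf{B}\to\mathbf{B}$ such that the colouring takes at most $l$ values on embeddings of $\mathbf{A}$ into $f(\mathbf{B})$. $\mathbf{B}$ has finite big Ramsey degrees if every finite substructure has finite big Ramsey degree in $\mathbf{B}$. *)

theory Defs
  imports Complex_Main "HOL-Library.Extended_Nat" "HOL-Library.FuncSet" "HOL-Library.Countable_Set"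
begin

text \<open>A relational language is a set \<open>L\<close> of symbols together with an arity function \<open>ar\<close>. Tuples are lists;
  the interpretation \<open>rel A R\<close> is only relevant for \<open>R \<in> L\<close>.\<close>

record ('a, 'l) struct =
  verts :: "'a set"
  rel :: "'l \<Rightarrow> 'a list set"

definition L_structure :: "'l set \<Rightarrow> ('l \<Rightarrow> nat) \<Rightarrow> ('a, 'l) struct \<Rightarrow> bool" where
  "L_structure L ar A \<longleftrightarrow>
     (\<forall>R\<in>L. \<forall>xs\<in>rel A R. length xs = ar R \<and> set xs \<subseteq> verts A)"

definition induced_sub :: "('a, 'l) struct \<Rightarrow> 'a set \<Rightarrow> ('a, 'l) struct" where
  "induced_sub A S = \<lparr>verts = S, rel = (\<lambda>R. rel A R \<inter> lists S)\<rparr>"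

definition homomorphism ::
  "'l set \<Rightarrow> ('a \<Rightarrow> 'b) \<Rightarrow> ('a, 'l) struct \<Rightarrow> ('b, 'l) struct \<Rightarrow> bool" where
  "homomorphism L f A B \<longleftrightarrow>
     f \<in> verts A \<rightarrow> verts B \<and>
     (\<forall>R\<in>L. \<forall>xs\<in>lists (verts A). xs \<in> rel A R \<longrightarrow> map f xs \<in> rel B R)"

text \<open>No arity restriction on \<open>xs\<close> is needed below: in \<open>L\<close>-structures, tuples of the wrong length
  belong to neither relation.\<close>

definition embedding ::
  "'l set \<Rightarrow> ('a \<Rightarrow> 'b) \<Rightarrow> ('a, 'l) struct \<Rightarrow> ('b, 'l) struct \<Rightarrow> bool" where
  "embedding L f A B \<longleftrightarrow>
     f \<in> verts A \<rightarrow> verts B \<and> inj_on f (verts A) \<and>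
     (\<forall>R\<in>L. \<forall>xs\<in>lists (verts A). xs \<in> rel A R \<longleftrightarrow> map f xs \<in> rel B R)"

definition adjacent :: "'l set \<Rightarrow> ('a, 'l) struct \<Rightarrow> 'a \<Rightarrow> 'a \<Rightarrow> bool" where
  "adjacent L A u v \<longleftrightarrow>
     u \<in> verts A \<and> v \<in> verts A \<and> u \<noteq> v \<and> (\<exists>R\<in>L. [u, v] \<in> rel A R \<or> [v, u] \<in> rel A R)"

definition irreducible_struct :: "'l set \<Rightarrow> ('a, 'l) struct \<Rightarrow> bool" where
  "irreducible_struct L A \<longleftrightarrow> (\<forall>u\<in>verts A. \<forall>v\<in>verts A. u \<noteq> v \<longrightarrow> adjacent L A u v)"

definition is_cycle :: "'l set \<Rightarrow> ('a, 'l) struct \<Rightarrow> 'a list \<Rightarrow> bool" where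
  "is_cycle L A vs \<longleftrightarrow>
     length vs \<ge> 3 \<and> distinct vs \<and> set vs \<subseteq> verts A \<and>
     (\<forall>i. i + 1 < length vs \<longrightarrow> adjacent L A (vs ! i) (vs ! (i + 1))) \<and>
     adjacent L A (vs ! (length vs - 1)) (vs ! 0)"

definition induced_cycle :: "'l set \<Rightarrow> ('a, 'l) struct \<Rightarrow> 'a list \<Rightarrow> bool" where
  "induced_cycle L A vs \<longleftrightarrow>
     is_cycle L A vs \<and>
     (\<forall>i j. i < j \<and> j < length vs \<and> j \<noteq> i + 1 \<and> \<not> (i = 0 \<and> j = length vs - 1)
        \<longrightarrow> \<not> adjacent L A (vs ! i) (vs ! j))"

definition hom_embedding ::
  "'l set \<Rightarrow> ('a \<Rightarrow> 'b) \<Rightarrow> ('a, 'l) struct \<Rightarrow> ('b, 'l) struct \<Rightarrow> bool" where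
  "hom_embedding L f A B \<longleftrightarrow>
     homomorphism L f A B \<and>
     (\<forall>S\<subseteq>verts A. irreducible_struct L (induced_sub A S) \<longrightarrow> embedding L f (induced_sub A S) B)"

definition completion ::
  "'l set \<Rightarrow> ('a \<Rightarrow> 'b) \<Rightarrow> ('a, 'l) struct \<Rightarrow> ('b, 'l) struct \<Rightarrow> bool" where
  "completion L f A B \<longleftrightarrow>
     hom_embedding L f A B \<and> inj_on f (verts A) \<and> irreducible_struct L B"

definition has_completion :: "'l set \<Rightarrow> ('a, 'l) struct \<Rightarrow> ('b, 'l) struct \<Rightarrow> bool" where
  "has_completion L A B \<longleftrightarrow> (\<exists>f. completion L f A B)"

definition embeds :: "'l set \<Rightarrow> ('a, 'l) struct \<Rightarrow> ('b, 'l) struct \<Rightarrow> bool" where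
  "embeds L A B \<longleftrightarrow> (\<exists>f. embedding L f A B)"

text \<open>Embeddings are made extensional, so that each embedding is represented by exactly one
  HOL function; argument order as in \<open>binom(B, A)\<close>.\<close>

definition Embs :: "'l set \<Rightarrow> ('b, 'l) struct \<Rightarrow> ('a, 'l) struct \<Rightarrow> ('a \<Rightarrow> 'b) set" where
  "Embs L B A = {f \<in> extensional (verts A). embedding L f A B}"

definition ramsey_bound ::
  "'l set \<Rightarrow> ('a, 'l) struct \<Rightarrow> ('b, 'l) struct \<Rightarrow> enat \<Rightarrow> bool" where
  "ramsey_bound L A B l \<longleftrightarrow>
     (\<forall>(k::nat) \<chi>. \<chi> \<in> Embs L B A \<rightarrow> {..<k} \<longrightarrow>
        (\<exists>f. embedding L f B B \<and>
             enat (card (\<chi> ` Embs L (induced_sub B (f ` verts B)) A)) \<le> l))"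

definition big_ramsey_degree :: "'l set \<Rightarrow> ('a, 'l) struct \<Rightarrow> ('b, 'l) struct \<Rightarrow> enat" where
  "big_ramsey_degree L A B = (LEAST l. ramsey_bound L A B l)"

definition finite_big_ramsey_degrees :: "'l set \<Rightarrow> ('b, 'l) struct \<Rightarrow> bool" where
  "finite_big_ramsey_degrees L B \<longleftrightarrow>
     (\<forall>S\<subseteq>verts B. finite S \<longrightarrow> big_ramsey_degree L (induced_sub B S) B < \<infinity>)"

end

(*
  Enumerating the vertices of K as x_0, x_1, ..., the vertex x_n is coded by the word whose i-th letter is
  the isomorphism type of the pair (x_i, x_n). On all words over the finite alphabet of such types one
  defines a structure G: a word V is joined to a shorter word U as prescribed by the letter of V at
  position |U|, provided that for every i < |U| the triangle formed by this pair and a common neighbour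
  of the types U_i, V_i occurs in K. Every finite substructure of G has a completion to K, by induction:
  replace its vertices of minimal length m by one vertex per loop type; the letters at position m
  join that vertex to the others, so induced cycles through it are triangles, and the removed vertices
  can be restored as pairwise nonadjacent copies of it. Hence G has a completion to K.

  A rigid surjection W of the natural numbers acts on words by substitution and this action preserves
  the edges of G, so it yields a copy of K in K. Finitely many words lie in an envelope, the image of
  boundedly short words under a finite rigid surjection onto N values with N bounded. By the dual Ramsey
  theorem of Carlson and Simpson one can choose W such that the colour of a copy of a finite
  substructure depends only on its short words in the envelope, for which there are finitely many
  possibilities.

  The dual Ramsey theorem follows by fusion from the infinite Hales-Jewett theorem for left-variable
  words, which is proved with ultrafilters w on words and V on left-variable words such that
  w V(a) w = w for every letter a.
*)
theory Submission
  imports Defs "HOL-Analysis.Function_Topology"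
begin

section \<open>Compact right topological semigroups\<close>

text \<open>Multiplication by a fixed right factor is continuous. This is the kind of continuity
  that the product of ultrafilters has.\<close>

locale compact_right_semigroup =
  fixes X :: "'p::t2_space set" and mul :: "'p \<Rightarrow> 'p \<Rightarrow> 'p" (infixl "\<odot>" 70)
  assumes compact: "compact X" and nonempty: "X \<noteq> {}"
    and mul_closed: "p \<in> X \<Longrightarrow> q \<in> X \<Longrightarrow> p \<odot> q \<in> X"
    and assoc: "p \<in> X \<Longrightarrow> q \<in> X \<Longrightarrow> r \<in> X \<Longrightarrow> p \<odot> q \<odot> r = p \<odot> (q \<odot> r)"
    and cont: "q \<in> X \<Longrightarrow> continuous_on X (\<lambda>p. p \<odot> q)"
begin

text \<open>Zorn's lemma for reverse inclusion: compactness keeps the intersection of a chain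
  nonempty. \<open>P\<close> will be the property of being a subsemigroup or a left ideal.\<close>

lemma minimal_closed:
  assumes Y: "closed Y" "Y \<subseteq> X" "Y \<noteq> {}" "P Y"
    and Int: "\<And>C. C \<noteq> {} \<Longrightarrow> (\<And>A. A \<in> C \<Longrightarrow> P A \<and> A \<subseteq> X) \<Longrightarrow> P (\<Inter>C)"
  obtains N where "closed N" "N \<subseteq> Y" "N \<noteq> {}" "P N"
    "\<And>M. closed M \<Longrightarrow> M \<subseteq> N \<Longrightarrow> M \<noteq> {} \<Longrightarrow> P M \<Longrightarrow> M = N"
proof -
  define F where "F = {M. closed M \<and> M \<subseteq> Y \<and> M \<noteq> {} \<and> P M}"
  have "\<exists>N\<in>F. \<forall>M\<in>F. N \<supseteq> M \<longrightarrow> M = N"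
  proof (rule predicate_Zorn)
    show "partial_order_on F (relation_of (\<supseteq>) F)"
      by (rule partial_order_on_relation_ofI) auto
  next
    fix C assume C: "C \<in> Chains (relation_of (\<supseteq>) F)"
    have CF: "C \<subseteq> F" using C by (auto simp: Chains_def relation_of_def)
    have lin: "A \<subseteq> B \<or> B \<subseteq> A" if "A \<in> C" "B \<in> C" for A B
      using C that by (auto simp: Chains_def relation_of_def)
    show "\<exists>u\<in>F. \<forall>a\<in>C. u \<subseteq> a"
    proof (cases "C = {}")
      case True
      then show ?thesis using Y by (auto simp: F_def)
    next
      case False
      have fin: "\<exists>A\<in>C. A \<subseteq> \<Inter>B" if "finite B" "B \<subseteq> C" for B
        using that
      proof (induction B)
        case empty
        then show ?case using False by auto
      next
        case (insert b B)
        then obtain A where A: "A \<in> C" "A \<subseteq> \<Inter>B" by auto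
        have b: "b \<in> C" using insert.prems by simp
        show ?case
        proof (cases "A \<subseteq> b")
          case True
          then show ?thesis using A by (intro bexI[of _ A]) auto
        next
          case False
          then show ?thesis using A b lin[of A b] by (intro bexI[of _ b]) auto
        qed
      qed
      have "X \<inter> \<Inter>C \<noteq> {}"
      proof (rule compact_imp_fip[OF compact])
        show "closed T" if "T \<in> C" for T using that CF by (auto simp: F_def)
        fix B assume B: "finite B" "B \<subseteq> C"
        obtain A where "A \<in> C" "A \<subseteq> \<Inter>B" using fin[OF B] by auto
        moreover from this have "A \<noteq> {}" "A \<subseteq> Y" using CF by (auto simp: F_def)
        ultimately show "X \<inter> \<Inter>B \<noteq> {}" using Y(2) by blast
      qed
      moreover have "P (\<Inter>C)"
      proof (rule Int[OF False])
        show "P A \<and> A \<subseteq> X" if "A \<in> C" for A using subsetD[OF CF that] Y(2) by (auto simp: F_def)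
      qed
      moreover have "closed (\<Inter>C)" using CF by (auto simp: F_def)
      ultimately have "\<Inter>C \<in> F" using CF False by (auto simp: F_def)
      then show ?thesis by auto
    qed
  qed
  then obtain N where "N \<in> F" and N: "\<And>M. M \<in> F \<Longrightarrow> M \<subseteq> N \<Longrightarrow> M = N" by blast
  then show thesis by (intro that[of N]) (auto simp: F_def)
qed

lemma closed_mul_right:
  assumes "closed Y" "Y \<subseteq> X" "q \<in> X"
  shows "closed ((\<lambda>p. p \<odot> q) ` Y)"
proof -
  have "compact Y" using compact assms by (metis closed_Int_compact inf.absorb_iff1)
  then have "compact ((\<lambda>p. p \<odot> q) ` Y)"
    using cont[OF assms(3)] assms(2) compact_continuous_image continuous_on_subset by metis
  then show ?thesis by (rule compact_imp_closed)
qed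

text \<open>Ellis-Numakura: in a minimal closed subsemigroup \<open>N\<close>, minimality first
  gives \<open>N \<odot> p = N\<close>, so some \<open>q\<close> satisfies
  \<open>q \<odot> p = p\<close>. A second use of minimality shows that all of \<open>N\<close>, in
  particular \<open>p\<close> itself, does so.\<close>

lemma idempotent_exists:
  assumes Y: "closed Y" "Y \<subseteq> X" "Y \<noteq> {}" "\<And>p q. p \<in> Y \<Longrightarrow> q \<in> Y \<Longrightarrow> p \<odot> q \<in> Y"
  obtains p where "p \<in> Y" "p \<odot> p = p"
proof -
  obtain N where N: "closed N" "N \<subseteq> Y" "N \<noteq> {}" "\<forall>p\<in>N. \<forall>q\<in>N. p \<odot> q \<in> N"
    and min: "\<And>M. closed M \<Longrightarrow> M \<subseteq> N \<Longrightarrow> M \<noteq> {} \<Longrightarrow> \<forall>p\<in>M. \<forall>q\<in>M. p \<odot> q \<in> M \<Longrightarrow> M = N"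
    by (rule minimal_closed[of Y "\<lambda>N. \<forall>p\<in>N. \<forall>q\<in>N. p \<odot> q \<in> N"]) (use Y in blast)+
  have NX: "N \<subseteq> X" using N Y by auto
  obtain p where p: "p \<in> N" using N by auto
  have "(\<lambda>q. q \<odot> p) ` N = N"
  proof (rule min)
    show "closed ((\<lambda>q. q \<odot> p) ` N)" using closed_mul_right N NX p by blast
    have "a \<odot> p \<odot> (b \<odot> p) = (a \<odot> p \<odot> b) \<odot> p" if "a \<in> N" "b \<in> N" for a b
      using that p NX by (simp add: assoc mul_closed subset_iff)
    then show "\<forall>a\<in>(\<lambda>q. q \<odot> p) ` N. \<forall>b\<in>(\<lambda>q. q \<odot> p) ` N. a \<odot> b \<in> (\<lambda>q. q \<odot> p) ` N"
      using N p by auto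
  qed (use N p in auto)
  then obtain q where q: "q \<in> N" "q \<odot> p = p" using p by (metis imageE)
  have "{q \<in> N. q \<odot> p = p} = N"
  proof (rule min)
    have "closed (N \<inter> (\<lambda>q. q \<odot> p) -` {p})"
      using N NX p by (intro continuous_closed_preimage continuous_on_subset[OF cont]) auto
    moreover have "N \<inter> (\<lambda>q. q \<odot> p) -` {p} = {q \<in> N. q \<odot> p = p}" by auto
    ultimately show "closed {q \<in> N. q \<odot> p = p}" by simp
    show "\<forall>a\<in>{q \<in> N. q \<odot> p = p}. \<forall>b\<in>{q \<in> N. q \<odot> p = p}. a \<odot> b \<in> {q \<in> N. q \<odot> p = p}"
      using N p NX by (auto simp: assoc subset_iff)
  qed (use q in auto)
  then show thesis using that[of p] p N by auto
qed

text \<open>The last conclusion holds because \<open>X \<odot> n\<close> is a closed left ideal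
  inside \<open>N\<close> and therefore equals \<open>N\<close>.\<close>

lemma minimal_left_ideal:
  assumes J: "closed J" "J \<subseteq> X" "J \<noteq> {}" "\<And>p q. p \<in> X \<Longrightarrow> q \<in> J \<Longrightarrow> p \<odot> q \<in> J"
  obtains N where "closed N" "N \<subseteq> J" "N \<noteq> {}" "\<And>p q. p \<in> X \<Longrightarrow> q \<in> N \<Longrightarrow> p \<odot> q \<in> N"
    "\<And>n m. n \<in> N \<Longrightarrow> m \<in> N \<Longrightarrow> \<exists>p\<in>X. p \<odot> n = m"
proof -
  obtain N where N: "closed N" "N \<subseteq> J" "N \<noteq> {}" "\<forall>p\<in>X. \<forall>q\<in>N. p \<odot> q \<in> N"
    and min: "\<And>M. closed M \<Longrightarrow> M \<subseteq> N \<Longrightarrow> M \<noteq> {} \<Longrightarrow> \<forall>p\<in>X. \<forall>q\<in>M. p \<odot> q \<in> M \<Longrightarrow> M = N"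
    by (rule minimal_closed[of J "\<lambda>N. \<forall>p\<in>X. \<forall>q\<in>N. p \<odot> q \<in> N"]) (use J in blast)+
  have NX: "N \<subseteq> X" using N J by auto
  have "(\<lambda>p. p \<odot> n) ` X = N" if "n \<in> N" for n
  proof (rule min)
    show "closed ((\<lambda>p. p \<odot> n) ` X)"
      using that NX compact by (intro closed_mul_right compact_imp_closed) auto
    show "\<forall>p\<in>X. \<forall>q\<in>(\<lambda>p. p \<odot> n) ` X. p \<odot> q \<in> (\<lambda>p. p \<odot> n) ` X"
    proof clarify
      fix p r assume "p \<in> X" "r \<in> X"
      then have "p \<odot> (r \<odot> n) = (p \<odot> r) \<odot> n" "p \<odot> r \<in> X"
        using that NX by (auto simp: assoc mul_closed)
      then show "p \<odot> (r \<odot> n) \<in> (\<lambda>p. p \<odot> n) ` X" by blast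
    qed
  qed (use N that nonempty in auto)
  then show thesis using that[of N] N by blast
qed

end

section \<open>Ultrafilters on words\<close>

instance "fun" :: (type, t2_space) t2_space
proof
  fix f g :: "'a \<Rightarrow> 'b" assume "f \<noteq> g"
  then obtain i U V where "open U" "open V" "f i \<in> U" "g i \<in> V" "U \<inter> V = {}"
    by (metis ext hausdorff)
  moreover have "open ((\<lambda>h::'a \<Rightarrow> 'b. h i) -` W)" if "open W" for W
    using that by (intro open_vimage) (simp_all add: continuous_on_product_coordinates)
  ultimately show "\<exists>U V. open U \<and> open V \<and> f \<in> U \<and> g \<in> V \<and> U \<inter> V = {}"
    by (intro exI[of _ "(\<lambda>h. h i) -` U"] exI[of _ "(\<lambda>h. h i) -` V"]) auto
qed

text \<open>An ultrafilter is represented by its characteristic function, so that the topology of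
  pointwise convergence makes the ultrafilters on a type a closed subspace of a compact space.\<close>

definition ultra :: "('t set \<Rightarrow> bool) \<Rightarrow> bool" where
  "ultra p \<longleftrightarrow> p UNIV \<and> (\<forall>A B. p (A \<inter> B) \<longleftrightarrow> p A \<and> p B) \<and> (\<forall>A. p (- A) \<longleftrightarrow> \<not> p A)"

definition beta :: "'t set \<Rightarrow> ('t set \<Rightarrow> bool) set" where
  "beta D = {p. ultra p \<and> p D}"

text \<open>The extension of concatenation to ultrafilters, with \<open>p\<close> as the outer
  quantifier, so that the product is continuous in its left factor.\<close>

definition umul :: "('c list set \<Rightarrow> bool) \<Rightarrow> ('c list set \<Rightarrow> bool) \<Rightarrow> 'c list set \<Rightarrow> bool" where
  "umul p q = (\<lambda>A. p {s. q {t. s @ t \<in> A}})"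

definition umap :: "('s \<Rightarrow> 't) \<Rightarrow> ('s set \<Rightarrow> bool) \<Rightarrow> 't set \<Rightarrow> bool" where
  "umap f p = (\<lambda>A. p (f -` A))"

lemma ultraD:
  assumes "ultra p"
  shows "p UNIV" "p (A \<inter> B) \<longleftrightarrow> p A \<and> p B" "p (- A) \<longleftrightarrow> \<not> p A" "\<not> p {}"
  using assms unfolding ultra_def by (blast, blast, blast, metis Compl_UNIV_eq)

lemma ultra_mono: "ultra p \<Longrightarrow> p A \<Longrightarrow> A \<subseteq> B \<Longrightarrow> p B"
  by (metis inf.absorb_iff1 ultraD(2))

lemma ultra_Collect_conj: "ultra p \<Longrightarrow> p {x. P x \<and> Q x} \<longleftrightarrow> p {x. P x} \<and> p {x. Q x}"
  by (simp add: Collect_conj_eq ultraD)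

lemma ultra_Collect_ball:
  assumes "ultra p" "finite I"
  shows "p {x. \<forall>i\<in>I. P i x} \<longleftrightarrow> (\<forall>i\<in>I. p {x. P i x})"
  using assms(2)
proof induction
  case (insert i I)
  then show ?case using ultra_Collect_conj[OF assms(1), of "P i" "\<lambda>x. \<forall>i\<in>I. P i x"] by simp
qed (simp add: ultraD[OF assms(1)])

lemma ultra_ex: "ultra p \<Longrightarrow> p A \<Longrightarrow> \<exists>x. x \<in> A"
  by (metis equals0I ultraD(4))

lemma ultra_umap: "ultra p \<Longrightarrow> ultra (umap f p)"
  by (simp add: ultra_def umap_def vimage_Compl)

lemma ultra_umul:
  assumes p: "ultra p" and q: "ultra q" shows "ultra (umul p q)"
proof -
  have "{s. q {t. s @ t \<in> - A}} = - {s. q {t. s @ t \<in> A}}" for A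
  proof -
    have "{t. s @ t \<in> - A} = - {t. s @ t \<in> A}" for s by auto
    then show ?thesis by (auto simp: ultraD[OF q])
  qed
  then show ?thesis
    unfolding ultra_def umul_def
    using ultraD(1,3)[OF p] ultraD(1,2)[OF q] ultra_Collect_conj[OF p] ultra_Collect_conj[OF q]
    by (simp del: Compl_iff)
qed

lemma umul_beta:
  assumes p: "p \<in> beta D" and q: "q \<in> beta E" and DE: "\<And>s t. s \<in> D \<Longrightarrow> t \<in> E \<Longrightarrow> s @ t \<in> F"
  shows "umul p q \<in> beta F"
proof -
  have "q {t. s @ t \<in> F}" if "s \<in> D" for s
    using q DE that by (auto simp: beta_def elim!: ultra_mono)
  then have "p {s. q {t. s @ t \<in> F}}" using p by (auto simp: beta_def elim!: ultra_mono)
  then show ?thesis using p q ultra_umul[of p q] by (simp add: beta_def) (simp add: umul_def)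
qed

lemma umul_assoc: "umul (umul p q) r = umul p (umul q r)"
  by (simp add: umul_def)

lemma umap_umul:
  assumes "\<And>s t. f (s @ t) = f s @ f t"
  shows "umap f (umul p q) = umul (umap f p) (umap f q)"
  by (simp add: umap_def umul_def assms vimage_def)

text \<open>A closed subset of a Tychonoff product of copies of \<open>bool\<close>: each condition
  in \<open>ultra\<close> constrains at most three coordinates.\<close>

lemma compact_beta: "compact (beta D)"
proof -
  have "compact (UNIV :: ('a set \<Rightarrow> bool) set)"
  proof -
    have "compact_space (product_topology (\<lambda>_::'a set. euclidean :: bool topology) UNIV)"
      unfolding compact_space_product_topology
      by (simp add: compact_space_def finite_imp_compact)
    then show ?thesis
      by (simp only: euclidean_product_topology compact_space_def topspace_euclidean
          compactin_euclidean_iff)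
  qed
  moreover have "closed (beta D)"
  proof -
    have cl: "closed {p::'a set \<Rightarrow> bool. Q (p A) (p B) (p C)}" for Q A B C
    proof -
      have "continuous_on UNIV (\<lambda>p::'a set \<Rightarrow> bool. (p A, p B, p C))"
        by (intro continuous_intros continuous_on_product_coordinates)
      moreover have "closed {x. Q (fst x) (fst (snd x)) (snd (snd x))}"
        by (rule finite_imp_closed) simp
      ultimately show ?thesis
        using continuous_closed_vimage[of "{x. Q (fst x) (fst (snd x)) (snd (snd x))}"
            "\<lambda>p. (p A, p B, p C)"]
        by (simp add: vimage_def continuous_on_eq_continuous_at)
    qed
    have "beta D = {p. p UNIV} \<inter> (\<Inter>A. \<Inter>B. {p. p (A \<inter> B) \<longleftrightarrow> p A \<and> p B})
        \<inter> (\<Inter>A. {p. p (- A) \<longleftrightarrow> \<not> p A}) \<inter> {p. p D}"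
      by (auto simp: beta_def ultra_def)
    moreover have "closed ({p. p UNIV} \<inter> (\<Inter>A. \<Inter>B. {p. p (A \<inter> B) \<longleftrightarrow> p A \<and> p B})
        \<inter> (\<Inter>A. {p. p (- A) \<longleftrightarrow> \<not> p A}) \<inter> {p. p D})"
      by (intro closed_Int closed_INT ballI cl[of "\<lambda>a b c. a"]
          cl[of "\<lambda>a b c. a \<longleftrightarrow> b \<and> c"] cl[of "\<lambda>a b c. a \<longleftrightarrow> \<not> b"])
    ultimately show ?thesis by simp
  qed
  ultimately show ?thesis by (metis compact_Int_closed inf_top_left)
qed

lemma principal_beta: "d \<in> D \<Longrightarrow> (\<lambda>A. d \<in> A) \<in> beta D"
  by (simp add: beta_def ultra_def)

lemma compact_right_semigroup_beta:
  assumes "D \<noteq> {}" "\<And>s t. s \<in> D \<Longrightarrow> t \<in> D \<Longrightarrow> s @ t \<in> D"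
  shows "compact_right_semigroup (beta D) umul"
proof
  show "beta D \<noteq> {}" using assms(1) principal_beta by fastforce
  fix q
  have "continuous_on (beta D) (\<lambda>p. p {s. q {t. s @ t \<in> A}})" for A
    by (rule continuous_on_subset[OF continuous_on_product_coordinates]) simp
  then show "continuous_on (beta D) (\<lambda>p. umul p q)"
    unfolding umul_def by (rule continuous_on_coordinatewise_then_product)
qed (use assms umul_beta[of _ D _ D D] in \<open>simp_all add: compact_beta umul_assoc\<close>)

text \<open>\<open>w\<close> is a minimal idempotent of the ultrafilters on constant words and \<open>v \<le> w\<close> a minimal
  idempotent of the ultrafilters on all words, so that \<open>v\<close> becomes \<open>w\<close> under every substitution.
  Inverting \<open>v \<cdot> x \<cdot> v\<close> in the group with unit \<open>v\<close> gives the ultrafilter on left-variable words.\<close>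

lemma left_variable_ultrafilter:
  fixes S :: "'c set" and x :: 'c
  assumes x: "x \<notin> S"
  defines "ev \<equiv> \<lambda>a. map (id(x := a))"
  obtains w V where "ultra w" "ultra V" "w (lists S)" "V ((#) x ` lists (insert x S))"
    "\<And>a A. a \<in> S \<Longrightarrow> w A \<longleftrightarrow> w {y. V {v. w {t. y @ ev a v @ t \<in> A}}}"
proof -
  let ?T = "lists (insert x S)"
  interpret bS: compact_right_semigroup "beta (lists S)" umul
    by (rule compact_right_semigroup_beta) auto
  interpret bT: compact_right_semigroup "beta ?T" umul
    by (rule compact_right_semigroup_beta) auto
  have ST: "beta (lists S) \<subseteq> beta ?T"
    unfolding beta_def using lists_mono[of S "insert x S"] by (auto elim!: ultra_mono)
  obtain M where M: "closed M" "M \<subseteq> beta (lists S)" "M \<noteq> {}"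
      "\<And>p q. p \<in> beta (lists S) \<Longrightarrow> q \<in> M \<Longrightarrow> umul p q \<in> M"
      "\<And>n m. n \<in> M \<Longrightarrow> m \<in> M \<Longrightarrow> \<exists>p\<in>beta (lists S). umul p n = m"
    by (rule bS.minimal_left_ideal[of "beta (lists S)"])
      (auto simp: compact_imp_closed[OF compact_beta] bS.nonempty bS.mul_closed)
  obtain w where w: "w \<in> M" "umul w w = w"
    using bS.idempotent_exists[of M] M by (metis subset_iff)
  have wS: "w \<in> beta (lists S)" and wT: "w \<in> beta ?T" using w M ST by auto
  let ?J = "(\<lambda>p. umul p w) ` beta ?T"
  \<comment> \<open>The minimal left ideal is taken inside the left ideal of all products ending in
    \<open>w\<close>, so that its elements absorb \<open>w\<close> on the right.\<close>
  obtain N where N: "closed N" "N \<subseteq> ?J" "N \<noteq> {}"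
      "\<And>p q. p \<in> beta ?T \<Longrightarrow> q \<in> N \<Longrightarrow> umul p q \<in> N"
      "\<And>n m. n \<in> N \<Longrightarrow> m \<in> N \<Longrightarrow> \<exists>p\<in>beta ?T. umul p n = m"
  proof (rule bT.minimal_left_ideal[of ?J])
    show "closed ?J"
      by (intro bT.closed_mul_right wT compact_imp_closed compact_beta order_refl)
    show "?J \<subseteq> beta ?T" using wT by (auto intro: bT.mul_closed)
    show "?J \<noteq> {}" using bT.nonempty by auto
    show "umul p q \<in> ?J" if "p \<in> beta ?T" "q \<in> ?J" for p q
      using that by (auto simp: umul_assoc[symmetric] intro!: imageI bT.mul_closed)
  qed blast
  have NT: "N \<subseteq> beta ?T" using N wT bT.mul_closed by blast
  obtain u where u: "u \<in> N" "umul u u = u"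
    using bT.idempotent_exists[of N] N NT by (metis subset_iff)
  have Nw: "umul n w = n" if "n \<in> N" for n
    using that N(2) w by (auto simp: umul_assoc)
  \<comment> \<open>The factor \<open>w\<close> in front of \<open>u\<close> makes \<open>v\<close>
    absorb \<open>w\<close> on both sides.\<close>
  define v where "v = umul w u"
  have uw: "umul u w = u" by (rule Nw[OF u(1)])
  have uwu: "umul u (umul w u) = u" using uw u(2) by (simp add: umul_assoc[symmetric])
  have v: "v \<in> N" "umul v v = v" "umul v w = v" "umul w v = v"
  proof -
    show "v \<in> N" using N(4)[OF wT u(1)] by (simp add: v_def)
    show "umul v v = v" by (simp add: v_def umul_assoc uwu)
    show "umul v w = v" by (simp add: v_def umul_assoc uw)
    show "umul w v = v" by (simp add: v_def umul_assoc[symmetric] w(2))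
  qed
  have vT: "v \<in> beta ?T" using v NT by auto
  have ev_app: "ev a (s @ t) = ev a s @ ev a t" for a s t by (simp add: ev_def)
  have evS: "umap (ev a) p = p" if "p \<in> beta (lists S)" for a p
  proof
    fix A
    have eq: "p (ev a -` A) \<longleftrightarrow> p (ev a -` A \<inter> lists S)" "p A \<longleftrightarrow> p (A \<inter> lists S)"
      using that by (auto simp: beta_def ultraD)
    have "ev a l = l" if "l \<in> lists S" for l
      using that x unfolding ev_def by (intro map_idI) auto
    moreover have "f -` A \<inter> B = A \<inter> B" if "\<And>l. l \<in> B \<Longrightarrow> f l = l" for f :: "'c list \<Rightarrow> 'c list" and B
      using that by auto
    ultimately have "p (ev a -` A \<inter> lists S) \<longleftrightarrow> p (A \<inter> lists S)" by metis
    then show "umap (ev a) p A = p A" using eq by (simp add: umap_def)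
  qed
  have evT: "umap (ev a) p \<in> beta (lists S)" if "a \<in> S" "p \<in> beta ?T" for a p
  proof -
    have "ev a l \<in> lists S" if "l \<in> ?T" for l
      using that \<open>a \<in> S\<close> unfolding ev_def by (induction l) (auto split: if_splits)
    then have "p (ev a -` lists S)"
      using that by (auto simp: beta_def elim!: ultra_mono)
    then show ?thesis using that by (simp add: beta_def ultra_umap) (simp add: umap_def)
  qed
  \<comment> \<open>The image \<open>p\<close> of \<open>v\<close> is idempotent and lies in
    \<open>M\<close>. Minimality gives \<open>w = q p\<close> for some \<open>q\<close>, hence
    \<open>w p = w\<close>, whereas also \<open>w p = p\<close>.\<close>
  have evv: "umap (ev a) v = w" if a: "a \<in> S" for a
  proof -
    define p where "p = umap (ev a) v"
    have pS: "p \<in> beta (lists S)" using evT a vT by (simp add: p_def)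
    have pw: "umul p w = p" "umul w p = p" "umul p p = p"
      using arg_cong[OF v(3), of "umap (ev a)"] arg_cong[OF v(4), of "umap (ev a)"]
        arg_cong[OF v(2), of "umap (ev a)"]
      by (simp_all add: umap_umul[of "ev a", OF ev_app] evS[OF wS] p_def)
    then have "p \<in> M" using M(4)[OF pS w(1)] by simp
    then obtain q where "umul q p = w" using M(5) w by blast
    then have "umul w p = w" using pw(3) umul_assoc[of q p p] by simp
    then show ?thesis using pw(2) by (simp add: p_def)
  qed
  define X :: "'c list set \<Rightarrow> bool" where "X = (\<lambda>A. [x] \<in> A)"
  have X: "X \<in> beta {[x]}" unfolding X_def by (rule principal_beta) simp
  then have XT: "X \<in> beta ?T" by (auto simp: beta_def elim!: ultra_mono)
  define g where "g = umul v (umul X v)"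
  \<comment> \<open>The elements \<open>k\<close> of \<open>N\<close> with \<open>v k = k\<close>
    form a group with unit \<open>v\<close>. Left inverses suffice: if \<open>h\<close> is one of
    \<open>g\<close> and \<open>k\<close> one of \<open>h\<close>, then
    \<open>k = k h g = g\<close>, so that \<open>g h = v\<close>.\<close>
  have inv: "\<exists>h\<in>N. umul h k = v \<and> umul v h = h" if k: "k \<in> N" "umul v k = k" for k
  proof -
    obtain f where f: "f \<in> beta ?T" "umul f k = v" using N(5) k v by blast
    have "umul (umul v (umul f v)) k = v" using f k v by (simp add: umul_assoc)
    moreover have "umul v (umul v (umul f v)) = umul v (umul f v)"
      using v(2) by (simp add: umul_assoc[symmetric])
    moreover have "umul v (umul f v) \<in> N" using f v vT N(4) by auto
    ultimately show ?thesis by blast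
  qed
  have Nv: "umul n v = n" if n: "n \<in> N" for n
  proof -
    obtain f where "umul f v = n" using N(5)[OF v(1) n] by auto
    then show ?thesis using v(2) umul_assoc[of f v v] by simp
  qed
  have g: "g \<in> N" "umul v g = g"
    using N(4)[OF vT N(4)[OF XT v(1)]] v(2) umul_assoc[of v v "umul X v"] by (simp_all add: g_def)
  obtain h where h: "h \<in> N" "umul h g = v" "umul v h = h" using inv g by blast
  obtain k where k: "k \<in> N" "umul k h = v" "umul v k = k" using inv h by blast
  have "k = g" using Nv[OF k(1)] h(2) umul_assoc[of k h g] k(2) g(2) by simp
  then have gh: "umul g h = v" using k by simp
  define V where "V = umul X (umul v h)"
  have hT: "h \<in> beta ?T" using h NT by auto
  have V: "V \<in> beta ((#) x ` ?T)"
    unfolding V_def by (rule umul_beta[OF X bT.mul_closed[OF vT hT]]) auto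
  have vV: "umul v (umul V v) = v"
  proof -
    have "umul v (umul V v) = umul (umul v (umul X v)) (umul h v)"
      unfolding V_def by (simp only: umul_assoc)
    also have "\<dots> = v" using gh Nv[OF h(1)] by (simp add: g_def)
    finally show ?thesis .
  qed
  \<comment> \<open>Substituting \<open>a\<close> turns \<open>v V v = v\<close> into the required
    equation, because it turns \<open>v\<close> into \<open>w\<close>.\<close>
  have "umul w (umul (umap (ev a) V) w) = w" if "a \<in> S" for a
    using arg_cong[OF vV, of "umap (ev a)"] evv[OF that]
    by (simp add: umap_umul[of "ev a", OF ev_app])
  then have "w A \<longleftrightarrow> w {y. V {v. w {t. y @ ev a v @ t \<in> A}}}" if "a \<in> S" for a A
    using that by (auto simp: umul_def umap_def vimage_def fun_eq_iff)
  moreover have "ultra w" "ultra V" "w (lists S)" "V ((#) x ` ?T)"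
    using wS V by (simp_all add: beta_def)
  ultimately show thesis by (intro that[of w V])
qed

section \<open>Restricted growth functions and the infinite Hales-Jewett theorem\<close>

text \<open>A function with \<open>rgf\<close> is an infinite parameter word without letters, whose parameters first occur in
  increasing order. Acting on \<open>U\<close> replaces the first \<open>length U\<close> parameters and cuts off before the next one.\<close>

definition rgf :: "(nat \<Rightarrow> nat) \<Rightarrow> bool" where
  "rgf W \<longleftrightarrow> (\<forall>n. \<exists>i. W i = n \<and> (\<forall>j<i. W j < n))"

text \<open>With \<open>n \<le> W i\<close> in place of equality, all earlier values are below
  \<open>n\<close> by construction; for \<open>rgf W\<close> this is the first occurrence of
  \<open>n\<close>.\<close>

definition first :: "(nat \<Rightarrow> nat) \<Rightarrow> nat \<Rightarrow> nat" where
  "first W n = (LEAST i. n \<le> W i)"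

definition act :: "(nat \<Rightarrow> nat) \<Rightarrow> 'b list \<Rightarrow> 'b list" where
  "act W U = map (\<lambda>i. U ! W i) [0..<first W (length U)]"

lemma first_eqI: "n \<le> W i \<Longrightarrow> (\<And>j. j < i \<Longrightarrow> W j < n) \<Longrightarrow> first W n = i"
  unfolding first_def by (rule Least_equality) (assumption, meson not_le)

lemma less_first: "j < first W n \<Longrightarrow> W j < n"
  unfolding first_def using not_less_Least not_le by blast

lemma rgf_first:
  assumes "rgf W" shows "W (first W n) = n"
proof -
  obtain i where "W i = n" "\<forall>j<i. W j < n" using assms by (auto simp: rgf_def)
  then show ?thesis using first_eqI[of n W i] by auto
qed

lemma first_mono:
  assumes "rgf W" "m < n" shows "first W m < first W n"
proof (rule ccontr)
  assume a: "\<not> first W m < first W n"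
  show False
  proof (cases "first W n = first W m")
    case True
    then show ?thesis using rgf_first[OF assms(1)] assms(2) by (metis less_irrefl)
  next
    case False
    then show ?thesis using a less_first[of "first W n" W m] rgf_first[OF assms(1), of n] assms(2) by simp
  qed
qed

lemma length_act [simp]: "length (act W U) = first W (length U)"
  by (simp add: act_def)

lemma nth_act: "i < first W (length U) \<Longrightarrow> act W U ! i = U ! W i"
  by (simp add: act_def)

lemma set_act: "set (act W U) \<subseteq> set U"
proof -
  have "U ! W i \<in> set U" if "i < first W (length U)" for i
    by (rule nth_mem[OF less_first[OF that]])
  then show ?thesis by (auto simp: act_def)
qed

text \<open>Otherwise \<open>D\<close> and the complements of the finitely many colour classes would
  all be large although their intersection is empty.\<close>

lemma ultra_finite_colouring:
  assumes "ultra p" "p D" "finite (c ` D)"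
  obtains k where "p {x. c x = k}"
proof (rule ccontr)
  assume "\<not> thesis"
  then have "\<forall>k\<in>c ` D. p {x. c x \<noteq> k}"
    using that ultraD(3)[OF assms(1)] by (metis Collect_neg_eq)
  then have "p {x. \<forall>k\<in>c ` D. c x \<noteq> k}"
    using ultra_Collect_ball[OF assms(1,3), of "\<lambda>k x. c x \<noteq> k"] by simp
  then have "p (D \<inter> {x. \<forall>k\<in>c ` D. c x \<noteq> k})"
    using assms by (simp add: ultraD)
  moreover have "D \<inter> {x. \<forall>k\<in>c ` D. c x \<noteq> k} = {}" by auto
  ultimately show False using ultraD(4)[OF assms(1)] by simp
qed

text \<open>The values below \<open>d\<close> of \<open>X\<close> are the letters of the alphabet and the value \<open>d + n\<close> is the
  \<open>n\<close>-th parameter, so that \<open>act X ([0..<d] @ T)\<close> substitutes \<open>T\<close> for the parameters.\<close>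

theorem infinite_hales_jewett:
  fixes c :: "nat list \<Rightarrow> 'b"
  assumes fin: "finite ((\<lambda>T. c ([0..<d] @ T)) ` lists {..<d})"
  obtains X k where "rgf X" "\<forall>i<d. X i = i" "\<forall>T\<in>lists {..<d}. c (act X ([0..<d] @ T)) = k"
proof -
  define ev where "ev a = map (id(d := a))" for a :: nat
  obtain w V where w: "ultra w" and V: "ultra V" and wS: "w (lists {..<d})"
    and VL: "V ((#) d ` lists (insert d {..<d}))"
    and wV: "\<And>a A. a \<in> {..<d} \<Longrightarrow> w A \<longleftrightarrow> w {y. V {v. w {t. y @ ev a v @ t \<in> A}}}"
  proof (rule left_variable_ultrafilter[of d "{..<d}"])
    fix w V assume a: "ultra w" "ultra V" "w (lists {..<d})" "V ((#) d ` lists (insert d {..<d}))"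
      "\<And>a A. a \<in> {..<d} \<Longrightarrow> w A \<longleftrightarrow> w {y. V {v. w {t. y @ map (id(d := a)) v @ t \<in> A}}}"
    show thesis by (rule that[OF a[folded ev_def]])
  qed simp
  obtain k where k: "w {t. c ([0..<d] @ t) = k}"
    by (rule ultra_finite_colouring[OF w wS fin])
  define A where "A = {t. c ([0..<d] @ t) = k}"
  \<comment> \<open>Besides lying in \<open>A\<close>, a good word stays extendable: for almost
    every variable word \<open>v\<close>, with any letter put in for the variable, almost every
    continuation leads back to \<open>A\<close>.\<close>
  define good where "good p \<longleftrightarrow> p \<in> A \<and> (\<forall>a<d. V {v. w {t. p @ ev a v @ t \<in> A}})" for p
  have good: "w {y. good (q @ y)}" if q: "w {t. q @ t \<in> A}" for q
  proof -
    have "w {y. V {v. w {t. q @ y @ ev a v @ t \<in> A}}}" if "a \<in> {..<d}" for a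
      using wV[OF that, of "{t. q @ t \<in> A}"] q by simp
    then have "w {y. \<forall>a\<in>{..<d}. V {v. w {t. q @ y @ ev a v @ t \<in> A}}}"
      using ultra_Collect_ball[OF w, of "{..<d}" "\<lambda>a y. V {v. w {t. q @ y @ ev a v @ t \<in> A}}"] by simp
    then show ?thesis using q by (simp add: good_def ultra_Collect_conj[OF w] Ball_def)
  qed
  \<comment> \<open>\<open>L\<close> is the part of the final word \<open>X\<close> constructed so
    far behind the letters below \<open>d\<close>; its parameters are among the first
    \<open>n\<close>, and every substitution for them must give a good word.\<close>
  define inv where "inv n L \<longleftrightarrow> set L \<subseteq> {..<d+n} \<and>
      (\<forall>T\<in>lists {..<d}. length T = n \<longrightarrow> good (map ((!) ([0..<d] @ T)) L))" for n L
  have "\<exists>L. \<forall>n. inv n (L n) \<and> (\<exists>z. L (Suc n) = L n @ (d + n) # z)"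
  proof (rule dependent_nat_choice)
    have "w {t. good t}" using good[of "[]"] k by (simp add: A_def)
    then obtain y where y: "y \<in> lists {..<d}" "good y"
      using ultra_ex[OF w, of "lists {..<d} \<inter> {t. good t}"] wS by (auto simp: ultraD[OF w])
    have "map ((!) [0..<d]) y = y" using y by (intro map_idI) auto
    then show "\<exists>L. inv 0 L" using y by (intro exI[of _ y]) (auto simp: inv_def)
  next
    fix L n assume L: "inv n L"
    define TT where "TT = {T. set T \<subseteq> {..<d} \<and> length T = n}"
    have TT: "finite TT" unfolding TT_def by (rule finite_lists_length_eq) simp
    let ?p = "\<lambda>T. map ((!) ([0..<d] @ T)) L"
    \<comment> \<open>Only finitely many substitutions \<open>T\<close> have to be respected, so one
      \<open>v\<close> serves all of them; the same holds for \<open>y\<close> below.\<close>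
    have "V {v. \<forall>T\<in>TT. \<forall>a\<in>{..<d}. w {t. ?p T @ ev a v @ t \<in> A}}"
      unfolding ultra_Collect_ball[OF V TT] ultra_Collect_ball[OF V finite_lessThan]
      using L by (auto simp: inv_def TT_def good_def lists_eq_set)
    then have "V ((#) d ` lists (insert d {..<d}) \<inter> {v. \<forall>T\<in>TT. \<forall>a\<in>{..<d}. w {t. ?p T @ ev a v @ t \<in> A}})"
      using VL by (simp add: ultraD[OF V])
    from ultra_ex[OF V this] obtain v where v: "v \<in> (#) d ` lists (insert d {..<d})"
        "\<And>T a. T \<in> TT \<Longrightarrow> a < d \<Longrightarrow> w {t. ?p T @ ev a v @ t \<in> A}"
      by blast
    have "w {y. \<forall>T\<in>TT. \<forall>a\<in>{..<d}. good ((?p T @ ev a v) @ y)}"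
      unfolding ultra_Collect_ball[OF w TT] ultra_Collect_ball[OF w finite_lessThan]
      using v(2) by (intro ballI good) simp
    then have "w (lists {..<d} \<inter> {y. \<forall>T\<in>TT. \<forall>a\<in>{..<d}. good ((?p T @ ev a v) @ y)})"
      using wS by (simp add: ultraD[OF w])
    from ultra_ex[OF w this] obtain y where y: "y \<in> lists {..<d}"
        "\<And>T a. T \<in> TT \<Longrightarrow> a < d \<Longrightarrow> good ((?p T @ ev a v) @ y)"
      by blast
    obtain z where z: "v = d # z" "set z \<subseteq> insert d {..<d}" using v(1) by auto
    \<comment> \<open>The variable of \<open>v\<close> becomes the new parameter
      \<open>d + n\<close>, while the tail \<open>y\<close> consists of letters only.\<close>
    define r where "r = id(d := d + n)"
    let ?L = "L @ (d + n) # (map r z @ y)"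
    have "inv (Suc n) ?L" unfolding inv_def
    proof (intro conjI ballI impI)
      show "set ?L \<subseteq> {..<d + Suc n}" using L z y(1) by (auto simp: inv_def r_def)
    next
      fix T assume T: "T \<in> lists {..<d}" "length T = Suc n"
      then obtain T' a where T': "T = T' @ [a]" "T' \<in> TT" "a < d"
        by (cases T rule: rev_cases) (auto simp: TT_def)
      have len: "length T' = n" using T'(2) by (simp add: TT_def)
      have "map ((!) ([0..<d] @ T)) L = ?p T'"
        using L len by (intro map_cong) (auto simp: inv_def T'(1) nth_append)
      moreover have "map ((!) ([0..<d] @ T)) (map r z) = ev a z"
        using z(2) len T'(3) by (auto simp: ev_def r_def T'(1) nth_append)
      moreover have "map ((!) ([0..<d] @ T)) y = y"
        using y(1) by (intro map_idI) (auto simp: nth_append)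
      moreover have "([0..<d] @ T) ! (d + n) = a" using len by (simp add: T'(1) nth_append)
      ultimately have "map ((!) ([0..<d] @ T)) ?L = (?p T' @ ev a v) @ y"
        by (simp add: z(1)) (simp add: ev_def)
      then show "good (map ((!) ([0..<d] @ T)) ?L)" using y(2)[OF T'(2,3)] by (simp only:)
    qed
    then show "\<exists>L'. inv (Suc n) L' \<and> (\<exists>z. L' = L @ (d + n) # z)" by blast
  qed
  then obtain L where L: "\<And>n. inv n (L n)" "\<And>n. \<exists>z. L (Suc n) = L n @ (d + n) # z" by blast
  define M where "M n = [0..<d] @ L n" for n
  have pre: "\<exists>z. M (n + m) = M n @ z" for n m
  proof (induction m)
    case (Suc m)
    then show ?case using L(2)[of "n + m"] by (auto simp: M_def)
  qed simp
  have len: "d + n \<le> length (M n)" for n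
  proof (induction n)
    case (Suc n)
    then show ?case using L(2)[of n] by (auto simp: M_def)
  qed (simp add: M_def)
  \<comment> \<open>The words \<open>M n\<close> extend one another and define an infinite word;
    \<open>M (Suc i)\<close> is long enough to have a position \<open>i\<close>.\<close>
  define X where "X i = M (Suc i) ! i" for i
  have X: "X i = M n ! i" if "i < length (M n)" for i n
  proof (cases "n \<le> Suc i")
    case True
    then show ?thesis using pre[of n "Suc i - n"] that by (auto simp: X_def nth_append)
  next
    case False
    then show ?thesis using pre[of "Suc i" "n - Suc i"] len[of "Suc i"]
      by (auto simp: X_def nth_append)
  qed
  have XM: "X (length (M n)) = d + n" for n
  proof -
    obtain z where "M (Suc n) = M n @ (d + n) # z" using L(2)[of n] by (auto simp: M_def)
    then show ?thesis using X[of "length (M n)" "Suc n"] by simp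
  qed
  have XL: "X j < d + n" if "j < length (M n)" for j n
  proof -
    have "M n ! j \<in> set (M n)" using that by simp
    then show ?thesis using L(1)[of n] X[OF that] by (auto simp: M_def inv_def)
  qed
  have first: "first X (d + n) = length (M n)" for n
    by (rule first_eqI) (use XM XL in auto)
  have Xd: "X i = i" if "i < d" for i
    using that X[of i 0] by (simp add: M_def nth_append)
  have "rgf X"
    unfolding rgf_def
  proof
    fix n show "\<exists>i. X i = n \<and> (\<forall>j<i. X j < n)"
    proof (cases "n < d")
      case True
      then show ?thesis using Xd by (intro exI[of _ n]) auto
    next
      case False
      then show ?thesis using XM[of "n - d"] XL[of _ "n - d"]
        by (intro exI[of _ "length (M (n - d))"]) auto
    qed
  qed
  moreover have "c (act X ([0..<d] @ T)) = k" if T: "T \<in> lists {..<d}" for T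
  proof -
    let ?n = "length T"
    have "act X ([0..<d] @ T) = map ((!) ([0..<d] @ T)) (M ?n)"
      by (rule nth_equalityI) (simp_all add: first nth_act X)
    also have "\<dots> = [0..<d] @ map ((!) ([0..<d] @ T)) (L ?n)"
      by (simp add: M_def) (intro map_idI, simp add: nth_append)
    finally show ?thesis
      using L(1)[of ?n] T by (auto simp: inv_def good_def A_def)
  qed
  ultimately show thesis using that Xd by blast
qed

section \<open>The dual Ramsey theorem\<close>

lemma first_comp:
  assumes "rgf W" "rgf W'"
  shows "first (W' \<circ> W) n = first W (first W' n)"
proof (rule first_eqI)
  show "n \<le> (W' \<circ> W) (first W (first W' n))" by (simp add: rgf_first assms)
next
  fix j assume "j < first W (first W' n)"
  then show "(W' \<circ> W) j < n" using less_first[of "W j" W' n] less_first[of j W "first W' n"] by simp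
qed

lemma rgfI:
  assumes "\<And>n. W (first W n) = n"
  shows "rgf W"
  unfolding rgf_def
proof
  fix n show "\<exists>i. W i = n \<and> (\<forall>j<i. W j < n)"
    using assms less_first by (intro exI[of _ "first W n"]) auto
qed

lemma rgf_comp: "rgf W \<Longrightarrow> rgf W' \<Longrightarrow> rgf (W' \<circ> W)"
  by (rule rgfI) (simp add: first_comp rgf_first)

lemma rgf_id: "rgf id"
  unfolding rgf_def by auto

lemma act_comp:
  assumes "rgf W" "rgf W'"
  shows "act (W' \<circ> W) U = act W (act W' U)"
  by (rule nth_equalityI) (simp_all add: first_comp assms nth_act less_first)

lemma act_map: "act W (map f U) = map f (act W U)"
  by (rule nth_equalityI) (simp_all add: nth_act less_first)

text \<open>\<open>W\<close> takes the value \<open>length U\<close> at position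
  \<open>first W (length U)\<close>, which therefore carries \<open>x\<close>; earlier positions
  refer to \<open>U\<close> only.\<close>

lemma act_append:
  assumes "rgf W"
  obtains z where "act W (U @ x # T) = act W U @ x # z" "set z \<subseteq> set (U @ x # T)"
proof -
  let ?V = "U @ x # T" and ?p = "first W (length U)"
  have p: "?p < first W (length ?V)" using assms by (intro first_mono) auto
  have "take ?p (act W ?V) = act W U"
    using p by (intro nth_equalityI) (auto simp: nth_act nth_append less_first)
  moreover have "act W ?V ! ?p = x"
    using p by (simp add: nth_act rgf_first assms)
  ultimately have "act W ?V = act W U @ x # drop (Suc ?p) (act W ?V)"
    using p by (metis id_take_nth_drop length_act)
  moreover have "set (drop (Suc ?p) (act W ?V)) \<subseteq> set ?V"
    using set_drop_subset set_act by (rule subset_trans)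
  ultimately show thesis by (rule that)
qed

lemma rgf_le: assumes "rgf W" shows "W i \<le> i"
proof (rule ccontr)
  assume "\<not> W i \<le> i"
  have "strict_mono (first W)" using first_mono[OF assms] by (simp add: strict_mono_def)
  then have "W i \<le> first W (W i)" by (rule strict_mono_imp_increasing)
  then have "i < first W (W i)" using \<open>\<not> W i \<le> i\<close> by simp
  then show False using less_first[of i W "W i"] by simp
qed

section \<open>Finite restricted growth functions, that is, rigid surjections onto
  \<open>{..<k}\<close>\<close>

definition frgf :: "nat \<Rightarrow> nat list \<Rightarrow> bool" where
  "frgf k V \<longleftrightarrow> set V \<subseteq> {..<k} \<and> (\<forall>n<k. \<exists>i<length V. V ! i = n \<and> (\<forall>j<i. V ! j < n))"

lemma frgf_act:
  assumes W: "rgf W" and V: "frgf k V"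
  shows "frgf k (act W V)"
  unfolding frgf_def
proof (intro conjI allI impI)
  show "set (act W V) \<subseteq> {..<k}" using V set_act[of W V] by (auto simp: frgf_def)
  fix n assume "n < k"
  then obtain i where i: "i < length V" "V ! i = n" "\<forall>j<i. V ! j < n"
    using V by (auto simp: frgf_def)
  have f: "first W i < first W (length V)" by (rule first_mono[OF W i(1)])
  show "\<exists>i<length (act W V). act W V ! i = n \<and> (\<forall>j<i. act W V ! j < n)"
  proof (intro exI conjI allI impI)
    show "first W i < length (act W V)" using f by simp
    show "act W V ! first W i = n" using f i by (simp add: nth_act rgf_first W)
    fix j assume "j < first W i"
    then show "act W V ! j < n" using f i(3) less_first[of j W i] by (simp add: nth_act)
  qed
qed

text \<open>The split is at the first occurrence of \<open>k\<close>, by which time every smaller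
  value has occurred.\<close>

lemma frgf_Suc_split:
  assumes "frgf (Suc k) V"
  obtains V' T where "V = V' @ k # T" "frgf k V'" "T \<in> lists {..<Suc k}"
proof -
  have V: "set V \<subseteq> {..<Suc k}" "\<And>n. n < Suc k \<Longrightarrow> \<exists>i<length V. V ! i = n \<and> (\<forall>j<i. V ! j < n)"
    using assms by (auto simp: frgf_def)
  obtain i where i: "i < length V" "V ! i = k" "\<forall>j<i. V ! j < k" using V(2)[of k] by auto
  have "V = take i V @ k # drop (Suc i) V" using i id_take_nth_drop by metis
  moreover have "frgf k (take i V)"
    unfolding frgf_def
  proof (intro conjI allI impI)
    show "set (take i V) \<subseteq> {..<k}" using i by (auto simp: set_conv_nth)
    fix n assume n: "n < k"
    then obtain i' where i': "i' < length V" "V ! i' = n" "\<forall>j<i'. V ! j < n" using V(2)[of n] by auto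
    have "\<not> i < i'" using i' i n by auto
    moreover have "i \<noteq> i'" using i' i n by auto
    ultimately have "i' < i" by simp
    then show "\<exists>j<length (take i V). take i V ! j = n \<and> (\<forall>j'<j. take i V ! j' < n)"
      using i' by (intro exI[of _ i']) auto
  qed
  moreover have "drop (Suc i) V \<in> lists {..<Suc k}"
    using V(1) set_drop_subset[of "Suc i" V] by auto
  ultimately show thesis by (rule that)
qed

lemma frgf_Suc:
  assumes V: "frgf k V" and T: "T \<in> lists {..<Suc k}"
  shows "frgf (Suc k) (V @ k # T)"
  unfolding frgf_def
proof (intro conjI allI impI)
  show "set (V @ k # T) \<subseteq> {..<Suc k}" using V T by (auto simp: frgf_def)
  fix n assume n: "n < Suc k"
  show "\<exists>i<length (V @ k # T). (V @ k # T) ! i = n \<and> (\<forall>j<i. (V @ k # T) ! j < n)"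
  proof (cases "n = k")
    case True
    have "V ! j < k" if "j < length V" for j using V nth_mem[OF that] by (auto simp: frgf_def)
    then show ?thesis using True by (intro exI[of _ "length V"]) (auto simp: nth_append)
  next
    case False
    then have "n < k" using n by simp
    then obtain i where "i < length V" "V ! i = n" "\<forall>j<i. V ! j < n"
      using V unfolding frgf_def by blast
    then show ?thesis by (intro exI[of _ i]) (auto simp: nth_append)
  qed
qed

lemma frgf_image:
  assumes "frgf k V" shows "set (V @ [k]) = {..<Suc k}"
proof -
  have "n \<in> set V" if "n < k" for n
    using assms that unfolding frgf_def by (metis nth_mem)
  moreover have "set V \<subseteq> {..<k}" using assms by (simp add: frgf_def)
  ultimately show ?thesis by (auto simp: less_Suc_eq)
qed

text \<open>Infinite Hales-Jewett is applied with \<open>Suc m\<close> letters, which stand for the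
  positions of \<open>V @ [k]\<close>. A colour there is the family of the colours for all
  \<open>V\<close> of length \<open>m\<close>, so that these finitely many \<open>V\<close> are
  treated at once. As \<open>X\<close> fixes the values up to \<open>m\<close>, it leaves the prefix
  \<open>V @ [k]\<close> alone.\<close>

lemma dual_ramsey_step:
  fixes c :: "nat list \<Rightarrow> 'b"
  assumes fin: "finite (c ` {V. frgf (Suc k) V})" and W: "rgf W"
  shows "\<exists>X. rgf X \<and> (\<forall>i\<le>m. X i = i) \<and>
    (\<forall>V T T'. frgf k V \<longrightarrow> length V = m \<longrightarrow> T \<in> lists {..<Suc k} \<longrightarrow> T' \<in> lists {..<Suc k}
      \<longrightarrow> c (act (X \<circ> W) (V @ k # T)) = c (act (X \<circ> W) (V @ k # T')))"
proof -
  let ?d = "Suc m"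
  define FV where "FV = {V. frgf k V \<and> length V = m}"
  have "FV \<subseteq> {V. set V \<subseteq> {..<k} \<and> length V = m}" by (auto simp: FV_def frgf_def)
  then have FV: "finite FV" by (rule finite_subset) (simp add: finite_lists_length_eq)
  define c' where "c' Z = restrict (\<lambda>V. c (act W (map ((!) (V @ [k])) Z))) FV" for Z
  have sub: "map ((!) (V @ [k])) ([0..<?d] @ T) = V @ k # map ((!) (V @ [k])) T" if "V \<in> FV" for V T
  proof -
    have "map ((!) (V @ [k])) [0..<length (V @ [k])] = V @ [k]" by (rule map_nth)
    then show ?thesis using that by (auto simp: FV_def nth_append)
  qed
  have subT: "map ((!) (V @ [k])) T \<in> lists {..<Suc k}" if "V \<in> FV" "T \<in> lists {..<?d}" for V T
  proof -
    have "(V @ [k]) ! i \<in> {..<Suc k}" if "i < ?d" for i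
      using frgf_image[of k V] nth_mem[of i "V @ [k]"] \<open>V \<in> FV\<close> that by (auto simp: FV_def)
    then show ?thesis using that by auto
  qed
  have "(\<lambda>T. c' ([0..<?d] @ T)) ` lists {..<?d} \<subseteq> FV \<rightarrow>\<^sub>E c ` {V. frgf (Suc k) V}"
  proof (rule image_subsetI)
    fix T assume T: "T \<in> lists {..<?d}"
    have "c (act W (map ((!) (V @ [k])) ([0..<?d] @ T))) \<in> c ` {V. frgf (Suc k) V}" if "V \<in> FV" for V
    proof -
      have "frgf (Suc k) (V @ k # map ((!) (V @ [k])) T)"
        using that subT[OF that T] by (intro frgf_Suc) (auto simp: FV_def)
      then show ?thesis unfolding sub[OF that] using frgf_act[OF W] by blast
    qed
    then show "c' ([0..<?d] @ T) \<in> FV \<rightarrow>\<^sub>E c ` {V. frgf (Suc k) V}" by (auto simp: c'_def)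
  qed
  then have "finite ((\<lambda>T. c' ([0..<?d] @ T)) ` lists {..<?d})"
    by (rule finite_subset) (intro finite_PiE FV fin)
  then obtain X \<kappa> where X: "rgf X" "\<forall>i<?d. X i = i"
    "\<forall>T\<in>lists {..<?d}. c' (act X ([0..<?d] @ T)) = \<kappa>"
    by (rule infinite_hales_jewett)
  have "c (act (X \<circ> W) (V @ k # T)) = \<kappa> V"
    if V: "frgf k V" "length V = m" and T: "T \<in> lists {..<Suc k}" for V T
  proof -
    have "V \<in> FV" using V by (simp add: FV_def)
    \<comment> \<open>All values below \<open>Suc k\<close> occur in \<open>V @ [k]\<close>, so
      every tail \<open>T\<close> arises by substitution from a tail over \<open>Suc m\<close>
      letters.\<close>
    have "{..<Suc k} = (!) (V @ [k]) ` {..<?d}"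
      using frgf_image[OF V(1)] V(2) by (auto simp: set_conv_nth image_def)
    then obtain T0 where T0: "T0 \<in> lists {..<?d}" "T = map ((!) (V @ [k])) T0"
      using T by (metis imageE lists_image)
    have "act (X \<circ> W) (V @ k # T) = act W (map ((!) (V @ [k])) (act X ([0..<?d] @ T0)))"
      unfolding act_comp[OF W X(1)] T0(2) sub[OF \<open>V \<in> FV\<close>, symmetric] act_map ..
    then have "c (act (X \<circ> W) (V @ k # T)) = c' (act X ([0..<?d] @ T0)) V"
      using \<open>V \<in> FV\<close> by (simp add: c'_def)
    then show ?thesis using bspec[OF X(3) T0(1)] by simp
  qed
  then show ?thesis using X by (intro exI[of _ X]) simp
qed

text \<open>Induction on \<open>k\<close>: a fusion makes the colour of \<open>V @ k # T\<close>
  independent of \<open>T\<close>, and then the induction hypothesis applies to the colour of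
  \<open>V @ [k]\<close>.\<close>

theorem dual_ramsey:
  fixes c :: "nat list \<Rightarrow> 'b"
  assumes "finite (c ` {V. frgf k V})"
  obtains W \<kappa> where "rgf W" "\<And>V. frgf k V \<Longrightarrow> c (act W V) = \<kappa>"
  using assms
proof (induction k arbitrary: c thesis)
  case 0
  have "V = []" if "frgf 0 V" for V using that by (auto simp: frgf_def)
  then show ?case using 0(1)[OF rgf_id] by blast
next
  case (Suc k)
  define P where "P m W \<longleftrightarrow> (\<forall>V T T'. frgf k V \<longrightarrow> length V = m \<longrightarrow> T \<in> lists {..<Suc k} \<longrightarrow>
    T' \<in> lists {..<Suc k} \<longrightarrow> c (act W (V @ k # T)) = c (act W (V @ k # T')))" for m W
  \<comment> \<open>Stage \<open>n\<close> settles the prefixes \<open>V\<close> of length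
    \<open>n\<close> by composing with an \<open>X\<close> that fixes all values up to
    \<open>n\<close>; such values never change again.\<close>
  have "\<exists>f. \<forall>n. rgf (f n) \<and> (\<exists>X. rgf X \<and> (\<forall>i\<le>n. X i = i) \<and> f (Suc n) = X \<circ> f n \<and> P n (f (Suc n)))"
  proof (rule dependent_nat_choice)
    show "\<exists>W. rgf W" using rgf_id by blast
    fix W m assume W: "rgf W"
    obtain X where X: "rgf X" "\<forall>i\<le>m. X i = i" "P m (X \<circ> W)"
      using dual_ramsey_step[OF Suc.prems(2) W, of m] unfolding P_def by (elim exE conjE)
    show "\<exists>W'. rgf W' \<and> (\<exists>X. rgf X \<and> (\<forall>i\<le>m. X i = i) \<and> W' = X \<circ> W \<and> P m W')"
      by (intro exI[of _ "X \<circ> W"] exI[of _ X] conjI rgf_comp[OF W] X refl)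
  qed
  then obtain f where F: "\<forall>n. rgf (f n) \<and>
    (\<exists>X. rgf X \<and> (\<forall>i\<le>n. X i = i) \<and> f (Suc n) = X \<circ> f n \<and> P n (f (Suc n)))" ..
  have f: "rgf (f n)" and Pf: "P n (f (Suc n))"
    and fS: "\<exists>X. rgf X \<and> (\<forall>i\<le>n. X i = i) \<and> f (Suc n) = X \<circ> f n" for n
    using F[rule_format, of n] by blast+
  have tail: "\<exists>Z. rgf Z \<and> (\<forall>i\<le>m. Z i = i) \<and> f (m + n) = Z \<circ> f m" for m n
  proof (induction n)
    case 0
    show ?case by (rule exI[of _ id], intro conjI rgf_id) auto
  next
    case (Suc n)
    then obtain Z where Z: "rgf Z" "\<forall>i\<le>m. Z i = i" "f (m + n) = Z \<circ> f m" by blast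
    obtain X where X: "rgf X" "\<forall>i\<le>m + n. X i = i" "f (Suc (m + n)) = X \<circ> f (m + n)"
      using fS by blast
    show ?case
      by (rule exI[of _ "X \<circ> Z"], intro conjI rgf_comp[OF Z(1) X(1)]) (use X Z in \<open>auto simp: comp_assoc\<close>)
  qed
  \<comment> \<open>The limit of the fusion: \<open>f n i\<close> is final once it is at most
    \<open>n\<close>, and by \<open>rgf_le\<close> this is the case for
    \<open>n = i\<close>.\<close>
  define W where "W i = f i i" for i
  have W: "W i = f n i" if "f n i \<le> n" for n i
  proof -
    have "f (n + i) i = f n i" using tail[of n i] that by auto
    moreover have "f (i + n) i = f i i" using tail[of i n] rgf_le[OF f, of i i] by auto
    ultimately show ?thesis by (simp add: W_def add.commute)
  qed
  have first: "first W l = first (f n) l" if "l \<le> n" for l n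
  proof (rule first_eqI)
    show "l \<le> W (first (f n) l)" using that by (simp add: W[of n] rgf_first f)
    fix j assume "j < first (f n) l"
    then have "f n j < l" by (rule less_first)
    then show "W j < l" using W[of n j] that by simp
  qed
  have rgfW: "rgf W"
    by (rule rgfI) (simp add: first[OF order_refl] W[of n "first (f n) n" for n] rgf_first f)
  have actW: "act W U = act (f (length U)) U" for U :: "nat list"
  proof (rule nth_equalityI)
    fix i assume "i < length (act W U)"
    then have i: "i < first (f (length U)) (length U)" by (simp add: first[OF order_refl])
    then have "W i = f (length U) i" using less_first[OF i] by (intro W) simp
    then show "act W U ! i = act (f (length U)) U ! i" using i by (simp add: nth_act first[OF order_refl])
  qed (simp add: first[OF order_refl])
  have const: "c (act W (V @ k # T)) = c (act W (V @ [k]))"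
    if V: "frgf k V" and T: "T \<in> lists {..<Suc k}" for V T
  proof -
    let ?m = "length V"
    \<comment> \<open>On a word starting with \<open>V @ [k]\<close> the limit differs from stage
      \<open>Suc ?m\<close> by a \<open>Z\<close> that fixes this prefix, so only the tail
      changes.\<close>
    have *: "\<exists>T'\<in>lists {..<Suc k}. act W (V @ k # T) = act (f (Suc ?m)) (V @ k # T')"
      if T: "T \<in> lists {..<Suc k}" for T
    proof -
      obtain Z where Z: "rgf Z" "\<forall>i\<le>Suc ?m. Z i = i" "f (Suc ?m + length T) = Z \<circ> f (Suc ?m)"
        using tail by blast
      have "first Z ?m = ?m" by (rule first_eqI) (use Z in auto)
      then have "act Z V = V" using Z by (intro nth_equalityI) (auto simp: nth_act)
      then obtain z where z: "act Z (V @ k # T) = V @ k # z" "set z \<subseteq> set (V @ k # T)"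
        using act_append[OF Z(1), of V k T] by metis
      have "act W (V @ k # T) = act (f (Suc ?m)) (act Z (V @ k # T))"
        using actW[of "V @ k # T"] Z(3) act_comp[OF f Z(1)] by simp
      moreover have "set (V @ k # T) \<subseteq> {..<Suc k}"
        using frgf_Suc[OF V T] unfolding frgf_def by (rule conjunct1)
      then have "z \<in> lists {..<Suc k}" using subset_trans[OF z(2)] by (simp add: lists_eq_set)
      ultimately show ?thesis using z(1) by (intro bexI[of _ z]) simp_all
    qed
    obtain T1 T2 where "T1 \<in> lists {..<Suc k}" "T2 \<in> lists {..<Suc k}"
      "act W (V @ k # T) = act (f (Suc ?m)) (V @ k # T1)"
      "act W (V @ k # []) = act (f (Suc ?m)) (V @ k # T2)"
      using *[OF T] *[of "[]"] by auto
    then show ?thesis using Pf[of ?m] V unfolding P_def by metis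
  qed
  have "(\<lambda>V. c (act W (V @ [k]))) ` {V. frgf k V} \<subseteq> c ` {V. frgf (Suc k) V}"
    using frgf_act[OF rgfW frgf_Suc[of k _ "[]"]] by auto
  then have "finite ((\<lambda>V. c (act W (V @ [k]))) ` {V. frgf k V})"
    using Suc.prems(2) by (rule finite_subset)
  from Suc.IH[OF _ this] obtain W' \<kappa> where W': "rgf W'"
    "\<And>V. frgf k V \<Longrightarrow> c (act W (act W' V @ [k])) = \<kappa>" by metis
  have "c (act (W' \<circ> W) V) = \<kappa>" if V: "frgf (Suc k) V" for V
  proof -
    obtain V' T where VT: "V = V' @ k # T" "frgf k V'" "T \<in> lists {..<Suc k}"
      using V by (rule frgf_Suc_split)
    obtain z where z: "act W' V = act W' V' @ k # z" "set z \<subseteq> set V"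
      unfolding VT(1) by (rule act_append[OF W'(1)])
    have "z \<in> lists {..<Suc k}" using z(2) V by (auto simp: frgf_def)
    then show ?thesis
      using const[OF frgf_act[OF W'(1) VT(2)]] W'(2)[OF VT(2)]
      by (simp add: act_comp[OF rgfW W'(1)] z(1))
  qed
  then show ?case using Suc.prems(1) rgf_comp[OF rgfW W'(1)] by blast
qed

section \<open>Envelopes\<close>

lemma frgf_take:
  assumes V: "frgf k V" and "p \<le> length V"
  shows "\<exists>q\<le>k. set (take p V) = {..<q}"
  using assms(2)
proof (induction p)
  case 0
  show ?case by (rule exI[of _ 0]) simp
next
  case (Suc p)
  then obtain q where q: "q \<le> k" "set (take p V) = {..<q}" by auto
  have p: "p < length V" using Suc.prems by simp
  have ins: "set (take (Suc p) V) = insert (V ! p) {..<q}"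
    using p q(2) by (simp add: take_Suc_conv_app_nth)
  have Vk: "V ! p < k" using V nth_mem[OF p] by (auto simp: frgf_def)
  show ?case
  proof (cases "V ! p < q")
    case True
    then show ?thesis using ins q(1) by (intro exI[of _ q]) auto
  next
    case False
    then have "q < k" using Vk by simp
    then obtain i where i: "i < length V" "V ! i = q" "\<forall>j<i. V ! j < q"
      using V unfolding frgf_def by blast
    have "\<not> i < p"
    proof
      assume "i < p"
      then have "q \<in> set (take p V)" using i p by (auto simp: in_set_conv_nth)
      then show False using q(2) by simp
    qed
    moreover have "\<not> p < i" using i(3) False by blast
    ultimately have "V ! p = q" using i(2) by (metis nat_neq_iff)
    then have "set (take (Suc p) V) = {..<Suc q}" using ins by (simp add: lessThan_Suc)
    then show ?thesis using \<open>q < k\<close> Suc_leI by blast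
  qed
qed

lemma frgf_snoc:
  assumes V: "frgf k V" and i: "i < k"
  shows "frgf k (V @ [i])"
  unfolding frgf_def
proof (intro conjI allI impI)
  show "set (V @ [i]) \<subseteq> {..<k}" using assms by (auto simp: frgf_def)
  fix n assume "n < k"
  then obtain i' where "i' < length V" "V ! i' = n" "\<forall>j<i'. V ! j < n"
    using V unfolding frgf_def by blast
  then show "\<exists>i'<length (V @ [i]). (V @ [i]) ! i' = n \<and> (\<forall>j<i'. (V @ [i]) ! j < n)"
    by (intro exI[of _ i']) (auto simp: nth_append)
qed

lemma frgf_pad: "frgf k V \<Longrightarrow> frgf (k + d) (V @ [k..<k + d])"
proof (induction d)
  case (Suc d)
  then show ?case using frgf_Suc[of "k + d" "V @ [k..<k + d]" "[]"] by simp
qed simp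

text \<open>\<open>ys\<close> lists the distinct entries in the order of their first occurrence, and
  \<open>V\<close> records which entry stands where.\<close>

lemma frgf_factorization:
  "\<exists>ys V. distinct ys \<and> set ys = set xs \<and> frgf (length ys) V \<and> xs = map ((!) ys) V"
proof (induction xs rule: rev_induct)
  case Nil
  then show ?case by (intro exI[of _ "[]"]) (simp add: frgf_def)
next
  case (snoc x xs)
  then obtain ys V where ys: "distinct ys" "set ys = set xs" "frgf (length ys) V" "xs = map ((!) ys) V"
    by blast
  show ?case
  proof (cases "x \<in> set ys")
    case True
    then obtain i where i: "i < length ys" "ys ! i = x" by (auto simp: in_set_conv_nth)
    show ?thesis
    proof (intro exI conjI)
      show "frgf (length ys) (V @ [i])" by (rule frgf_snoc[OF ys(3) i(1)])
    qed (use ys True i in auto)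
  next
    case False
    have V: "set V \<subseteq> {..<length ys}" using ys(3) by (simp add: frgf_def)
    have "map ((!) (ys @ [x])) V = map ((!) ys) V"
      using V by (intro map_cong) (auto simp: nth_append)
    then have "xs @ [x] = map ((!) (ys @ [x])) (V @ [length ys])" using ys(4) by simp
    moreover have "frgf (length (ys @ [x])) (V @ [length ys])"
      using frgf_Suc[OF ys(3), of "[]"] by simp
    moreover have "distinct (ys @ [x])" "set (ys @ [x]) = set (xs @ [x])" using ys False by auto
    ultimately show ?thesis by blast
  qed
qed

text \<open>The word is cut off before the first value of \<open>V\<close> that has no replacement
  in \<open>t\<close>; in this way one \<open>V\<close> yields words of different lengths.\<close>

definition subst :: "'b list \<Rightarrow> nat list \<Rightarrow> 'b list" where
  "subst t V = map ((!) t) (takeWhile (\<lambda>v. v < length t) V)"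

text \<open>\<open>W\<close> moves the cut-off position \<open>?p\<close> to
  \<open>first W ?p\<close>. Hence acting on a word in an envelope changes the envelope
  \<open>V\<close> but not the short word \<open>t\<close>.\<close>

lemma act_subst:
  assumes W: "rgf W"
  shows "act W (subst t V) = subst t (act W V)"
proof -
  let ?P = "\<lambda>v. v < length t" and ?p = "length (takeWhile (\<lambda>v. v < length t) V)"
  have p: "?p \<le> length V" by (rule length_takeWhile_le)
  then have fp: "first W ?p \<le> first W (length V)"
    using first_mono[OF W, of ?p "length V"] by (cases "?p = length V") auto
  have P: "?P (V ! i)" if "i < ?p" for i
    using takeWhile_nth[OF that] nth_mem[OF that] set_takeWhileD by metis
  have "takeWhile ?P (act W V) = take (first W ?p) (act W V)"
  proof (rule takeWhile_eq_take_P_nth)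
    fix i assume "i < first W ?p" "i < length (act W V)"
    then show "?P (act W V ! i)" using less_first[of i W ?p] P by (simp add: nth_act)
  next
    assume a: "first W ?p < length (act W V)"
    then have "?p < length V" using p by (cases "?p = length V") auto
    then have "\<not> ?P (V ! ?p)" by (rule nth_length_takeWhile)
    then show "\<not> ?P (act W V ! first W ?p)" using a by (simp add: nth_act rgf_first W)
  qed
  then have tw: "subst t (act W V) = map ((!) t) (take (first W ?p) (act W V))"
    by (simp add: subst_def)
  show ?thesis
  proof (rule nth_equalityI)
    show "length (act W (subst t V)) = length (subst t (act W V))"
      unfolding tw using fp by (simp add: subst_def)
    fix i assume "i < length (act W (subst t V))"
    then have i: "i < first W ?p" by (simp add: subst_def)
    then have Wi: "W i < ?p" by (rule less_first)
    have "act W (subst t V) ! i = t ! (V ! W i)"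
      using i Wi takeWhile_nth[OF Wi] by (simp add: nth_act subst_def)
    moreover have "subst t (act W V) ! i = t ! (V ! W i)"
      unfolding tw using i fp by (simp add: nth_act)
    ultimately show "act W (subst t V) ! i = subst t (act W V) ! i" by simp
  qed
qed

text \<open>The parameters of the envelope are the columns of the table with rows \<open>U a\<close>, where \<open>None\<close> marks the
  positions behind the end of a row.\<close>

lemma envelope_exists:
  fixes U :: "'v \<Rightarrow> 'c list"
  assumes S: "finite S" and \<Sigma>: "finite \<Sigma>" and U: "\<And>a. a \<in> S \<Longrightarrow> U a \<in> lists \<Sigma>"
    and N: "N = card (S \<rightarrow>\<^sub>E insert None (Some ` \<Sigma>))"
  shows "\<exists>V t. frgf N V \<and> (\<forall>a\<in>S. set (t a) \<subseteq> \<Sigma> \<and> length (t a) \<le> N \<and> U a = subst (t a) V)"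
proof -
  define M where "M = (\<Sum>a\<in>S. length (U a))"
  have M: "length (U a) \<le> M" if "a \<in> S" for a
    unfolding M_def using that S by (intro member_le_sum) auto
  define sig where "sig i = restrict (\<lambda>a. if i < length (U a) then Some (U a ! i) else None) S" for i
  have U_in: "U a ! i \<in> \<Sigma>" if "a \<in> S" "i < length (U a)" for a i
    using U[OF that(1)] nth_mem[OF that(2)] by auto
  have sig: "sig i \<in> S \<rightarrow>\<^sub>E insert None (Some ` \<Sigma>)" for i
    using U_in by (auto simp: sig_def)
  obtain ys V0 where ys: "distinct ys" "set ys = set (map sig [0..<M])" "frgf (length ys) V0"
      "map sig [0..<M] = map ((!) ys) V0"
    using frgf_factorization by metis
  define k where "k = length ys"
  have lenV0: "length V0 = M" using arg_cong[OF ys(4), of length] by simp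
  have ysV: "ys ! (V0 ! i) = sig i" if "i < M" for i
    using arg_cong[OF ys(4), of "\<lambda>l. l ! i"] that lenV0 by simp
  have "k = card (set ys)" using ys(1) by (simp add: k_def distinct_card)
  also have "\<dots> \<le> N"
    unfolding N using sig ys(2) S \<Sigma> by (intro card_mono finite_PiE) auto
  finally have kN: "k \<le> N" .
  define V where "V = V0 @ [k..<N]"
  have "frgf N V" using frgf_pad[OF ys(3), of "N - k"] kN by (simp add: V_def k_def)
  moreover have "\<exists>t. set t \<subseteq> \<Sigma> \<and> length t \<le> N \<and> U a = subst t V" if a: "a \<in> S" for a
  proof -
    let ?p = "length (U a)"
    have p: "?p \<le> length V0" using M[OF a] lenV0 by simp
    obtain q where q: "q \<le> k" "set (take ?p V0) = {..<q}"
      using frgf_take[OF ys(3) p] by (auto simp: k_def)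
    \<comment> \<open>Row \<open>a\<close> is read off the \<open>q\<close> distinct columns that
      occur before its end; there the entries at \<open>a\<close> are never
      \<open>None\<close>.\<close>
    define t where "t = map (\<lambda>f. the (f a)) (take q ys)"
    have len: "length t = q" using q(1) by (simp add: t_def k_def)
    have V0q: "V0 ! i < q" if "i < ?p" for i
    proof -
      have "V0 ! i \<in> set (take ?p V0)" using that p by (auto simp: in_set_conv_nth)
      then show ?thesis using q(2) by simp
    qed
    have tV0: "t ! (V0 ! i) = U a ! i" if i: "i < ?p" for i
      using V0q[OF i] q(1) ysV[of i] i p lenV0 a by (simp add: t_def k_def sig_def)
    have "takeWhile (\<lambda>v. v < q) V = take ?p V"
    proof (rule takeWhile_eq_take_P_nth)
      fix i assume "i < ?p" "i < length V"
      then show "V ! i < q" using V0q p by (simp add: V_def nth_append)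
    next
      assume pV: "?p < length V"
      show "\<not> V ! ?p < q"
      \<comment> \<open>Inside the table the column at \<open>?p\<close> has the entry
        \<open>None\<close> at \<open>a\<close>, unlike all earlier columns, so it is a new one;
        beyond the table there is a padding value, which is at least \<open>k\<close>.\<close>
      proof (cases "?p < M")
        case True
        show ?thesis
        proof
          assume "V ! ?p < q"
          then have "V0 ! ?p \<in> set (take ?p V0)" using q(2) True lenV0 by (simp add: V_def nth_append)
          then obtain i where i: "i < ?p" "V0 ! i = V0 ! ?p" by (auto simp: in_set_conv_nth)
          then have "sig i = sig ?p" using ysV[of i] ysV[of ?p] True by simp
          then have "sig i a = sig ?p a" by simp
          then show False using i(1) a by (simp add: sig_def)
        qed
      next
        case False
        then have "?p = length V0" using p lenV0 by simp
        then show ?thesis using pV q(1) by (simp add: V_def nth_append)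
      qed
    qed
    then have "subst t V = map ((!) t) (take ?p V0)"
      using p by (simp add: subst_def len V_def)
    also have "\<dots> = U a" using p tV0 by (intro nth_equalityI) auto
    finally have "U a = subst t V" ..
    moreover have "set t \<subseteq> \<Sigma>"
    proof
      fix y assume "y \<in> set t"
      then obtain j where j: "j < q" "y = t ! j" by (auto simp: in_set_conv_nth len)
      then have "j \<in> set (take ?p V0)" using q(2) by simp
      then obtain i where "i < ?p" "V0 ! i = j" by (auto simp: in_set_conv_nth)
      then show "y \<in> \<Sigma>" using tV0 j(2) U_in[OF a] by metis
    qed
    ultimately show ?thesis using len q(1) kN by (intro exI[of _ t]) simp
  qed
  ultimately show ?thesis by metis
qed

section \<open>Binary structures and induced cycles\<close>

text \<open>Unary relations are recorded at the pairs \<open>(x, x)\<close>, next to the loops; the arities keep them apart.\<close>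

definition edge :: "'l set \<Rightarrow> ('l \<Rightarrow> nat) \<Rightarrow> ('a, 'l) struct \<Rightarrow> 'a \<Rightarrow> 'a \<Rightarrow> 'l set" where
  "edge L ar A x y = {R \<in> L. ar R = 2 \<and> [x, y] \<in> rel A R \<or> ar R = 1 \<and> x = y \<and> [x] \<in> rel A R}"

definition of_edge :: "('l \<Rightarrow> nat) \<Rightarrow> 'a set \<Rightarrow> ('a \<Rightarrow> 'a \<Rightarrow> 'l set) \<Rightarrow> ('a, 'l) struct" where
  "of_edge ar V e = \<lparr>verts = V, rel = (\<lambda>R. {[x] | x. x \<in> V \<and> ar R = 1 \<and> R \<in> e x x} \<union>
     {[x, y] | x y. x \<in> V \<and> y \<in> V \<and> ar R = 2 \<and> R \<in> e x y})\<rparr>"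

lemma verts_of_edge [simp]: "verts (of_edge ar V e) = V"
  by (simp add: of_edge_def)

lemma L_structure_of_edge: "L_structure L ar (of_edge ar V e)"
  by (auto simp: L_structure_def of_edge_def)

lemma verts_induced_sub [simp]: "verts (induced_sub A S) = S"
  by (simp add: induced_sub_def)

lemma L_structure_induced_sub: "L_structure L ar A \<Longrightarrow> L_structure L ar (induced_sub A S)"
  by (auto simp: L_structure_def induced_sub_def)

lemma edge_induced_sub: "x \<in> S \<Longrightarrow> y \<in> S \<Longrightarrow> edge L ar (induced_sub A S) x y = edge L ar A x y"
  by (auto simp: edge_def induced_sub_def)

lemma edge_of_edge:
  assumes "\<forall>R\<in>L. ar R = 1 \<or> ar R = 2" "e x y \<subseteq> L" "x \<noteq> y \<Longrightarrow> \<forall>R\<in>e x y. ar R = 2" "x \<in> V" "y \<in> V"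
  shows "edge L ar (of_edge ar V e) x y = e x y"
  using assms by (auto simp: edge_def of_edge_def)

lemma adjacent_iff_edge:
  assumes "L_structure L ar A"
  shows "adjacent L A x y \<longleftrightarrow>
    x \<in> verts A \<and> y \<in> verts A \<and> x \<noteq> y \<and> edge L ar A x y \<union> edge L ar A y x \<noteq> {}"
proof -
  have "ar R = 2" if "R \<in> L" "[u, v] \<in> rel A R" for R u v
  proof -
    have "length [u, v] = ar R" using assms that unfolding L_structure_def by blast
    then show ?thesis by simp
  qed
  then show ?thesis unfolding adjacent_def edge_def by auto
qed

text \<open>The condition on pairs concerns only \<open>xs\<close> itself, so that the lemma serves
  embeddings as well as maps that preserve labels merely on adjacent pairs.\<close>

lemma rel_map_iff:
  assumes A: "L_structure L ar A" and B: "L_structure L ar B"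
    and ar: "\<forall>R\<in>L. ar R = 1 \<or> ar R = 2" and R: "R \<in> L" and xs: "xs \<in> lists V"
    and "\<And>x. x \<in> V \<Longrightarrow> edge L ar B (f x) (f x) = edge L ar A x x"
    and "\<And>x y. xs = [x, y] \<Longrightarrow> edge L ar B (f x) (f y) = edge L ar A x y"
  shows "xs \<in> rel A R \<longleftrightarrow> map f xs \<in> rel B R"
proof (cases "length xs = ar R")
  case False
  then have "xs \<notin> rel A R" "map f xs \<notin> rel B R"
    using A B R unfolding L_structure_def by (blast, metis length_map)
  then show ?thesis by simp
next
  case True
  moreover have "ar R = 1 \<or> ar R = 2" using ar R by blast
  ultimately consider x where "ar R = 1" "xs = [x]" | x y where "ar R = 2" "xs = [x, y]"
    by (auto simp: length_Suc_conv numeral_2_eq_2)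
  then show ?thesis
  proof cases
    case 1
    then have "R \<in> edge L ar B (f x) (f x) \<longleftrightarrow> R \<in> edge L ar A x x" using assms(6) xs by auto
    then show ?thesis using 1 R by (auto simp: edge_def)
  next
    case 2
    then have "R \<in> edge L ar B (f x) (f y) \<longleftrightarrow> R \<in> edge L ar A x y" using assms(7) by auto
    then show ?thesis using 2 R by (auto simp: edge_def)
  qed
qed

lemma embedding_iff_edge:
  assumes A: "L_structure L ar A" and B: "L_structure L ar B" and ar: "\<forall>R\<in>L. ar R = 1 \<or> ar R = 2"
  shows "embedding L f A B \<longleftrightarrow> f \<in> verts A \<rightarrow> verts B \<and> inj_on f (verts A) \<and>
    (\<forall>x\<in>verts A. \<forall>y\<in>verts A. edge L ar B (f x) (f y) = edge L ar A x y)"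
    (is "_ \<longleftrightarrow> ?r")
proof
  assume e: "embedding L f A B"
  then have f: "f \<in> verts A \<rightarrow> verts B" and inj: "inj_on f (verts A)"
    unfolding embedding_def by blast+
  have "edge L ar B (f x) (f y) = edge L ar A x y" if "x \<in> verts A" "y \<in> verts A" for x y
  proof -
    have "[x, y] \<in> rel A R \<longleftrightarrow> [f x, f y] \<in> rel B R" "[x] \<in> rel A R \<longleftrightarrow> [f x] \<in> rel B R"
      if "R \<in> L" for R
    proof -
      have *: "\<forall>xs\<in>lists (verts A). xs \<in> rel A R \<longleftrightarrow> map f xs \<in> rel B R"
        using e that unfolding embedding_def by blast
      have "[x, y] \<in> lists (verts A)" "[x] \<in> lists (verts A)"
        using \<open>x \<in> verts A\<close> \<open>y \<in> verts A\<close> by simp_all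
      from bspec[OF * this(1)] bspec[OF * this(2)]
      show "[x, y] \<in> rel A R \<longleftrightarrow> [f x, f y] \<in> rel B R" "[x] \<in> rel A R \<longleftrightarrow> [f x] \<in> rel B R"
        by simp_all
    qed
    then show ?thesis unfolding edge_def inj_on_eq_iff[OF inj that] by blast
  qed
  then show ?r using f inj by blast
next
  assume r: ?r
  have "xs \<in> rel A R \<longleftrightarrow> map f xs \<in> rel B R" if "R \<in> L" "xs \<in> lists (verts A)" for R xs
    by (rule rel_map_iff[OF A B ar that]) (use r that in auto)
  then show "embedding L f A B" using r by (simp add: embedding_def)
qed

text \<open>Single vertices and adjacent pairs are irreducible substructures, and in an irreducible
  substructure all pairs are adjacent.\<close>

lemma hom_embedding_iff_edge:
  assumes A: "L_structure L ar A" and B: "L_structure L ar B" and ar: "\<forall>R\<in>L. ar R = 1 \<or> ar R = 2"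
  shows "hom_embedding L f A B \<longleftrightarrow> f \<in> verts A \<rightarrow> verts B \<and>
    (\<forall>x\<in>verts A. edge L ar B (f x) (f x) = edge L ar A x x) \<and>
    (\<forall>x y. adjacent L A x y \<longrightarrow> f x \<noteq> f y \<and> edge L ar B (f x) (f y) = edge L ar A x y)"
    (is "_ \<longleftrightarrow> ?r")
proof
  assume h: "hom_embedding L f A B"
  have emb: "f x \<noteq> f y \<and> edge L ar B (f x) (f y) = edge L ar A x y"
    if "adjacent L A x y" for x y
  proof -
    have xy: "x \<in> verts A" "y \<in> verts A" "x \<noteq> y" using that by (auto simp: adjacent_def)
    have "adjacent L A y x" using that by (auto simp: adjacent_def)
    then have "irreducible_struct L (induced_sub A {x, y})"
      using that by (auto simp: irreducible_struct_def adjacent_def induced_sub_def)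
    then have "embedding L f (induced_sub A {x, y}) B"
      using h xy by (auto simp: hom_embedding_def)
    then show ?thesis
      using xy by (simp add: embedding_iff_edge[OF L_structure_induced_sub[OF A] B ar] edge_induced_sub)
  qed
  have "edge L ar B (f x) (f x) = edge L ar A x x" if x: "x \<in> verts A" for x
  proof -
    have "irreducible_struct L (induced_sub A {x})" by (auto simp: irreducible_struct_def)
    then have "embedding L f (induced_sub A {x}) B"
      using h x by (auto simp: hom_embedding_def)
    then show ?thesis
      by (simp add: embedding_iff_edge[OF L_structure_induced_sub[OF A] B ar] edge_induced_sub)
  qed
  then show ?r using emb h by (auto simp: hom_embedding_def homomorphism_def)
next
  assume r: ?r
  have "map f xs \<in> rel B R" if R: "R \<in> L" and xs: "xs \<in> lists (verts A)" "xs \<in> rel A R" for R xs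
  proof -
    have "edge L ar B (f x) (f y) = edge L ar A x y" if "xs = [x, y]" for x y
    proof (cases "x = y")
      case False
      then have "adjacent L A x y" using xs R that by (auto simp: adjacent_def)
      then show ?thesis using r by blast
    qed (use r xs that in auto)
    then show ?thesis using rel_map_iff[OF A B ar R xs(1), of f] r xs(2) by blast
  qed
  then have "homomorphism L f A B" using r by (simp add: homomorphism_def)
  moreover have "embedding L f (induced_sub A S) B"
    if S: "S \<subseteq> verts A" and irr: "irreducible_struct L (induced_sub A S)" for S
  proof -
    have "adjacent L A x y" if "x \<in> S" "y \<in> S" "x \<noteq> y" for x y
    proof -
      have "adjacent L (induced_sub A S) x y" using irr that by (simp add: irreducible_struct_def)
      then show ?thesis using S by (auto simp: adjacent_def induced_sub_def)
    qed
    then have *: "f x \<noteq> f y \<and> edge L ar B (f x) (f y) = edge L ar A x y"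
      if "x \<in> S" "y \<in> S" "x \<noteq> y" for x y using r that by blast
    have "edge L ar B (f x) (f y) = edge L ar A x y" if "x \<in> S" "y \<in> S" for x y
      using * r S that by (cases "x = y") auto
    moreover have "inj_on f S" using * by (auto simp: inj_on_def)
    moreover have "f \<in> S \<rightarrow> verts B" using r S by auto
    ultimately show ?thesis
      by (simp add: embedding_iff_edge[OF L_structure_induced_sub[OF A] B ar] edge_induced_sub)
  qed
  ultimately show "hom_embedding L f A B" by (simp add: hom_embedding_def)
qed

lemma adjacent_sym: "adjacent L A x y \<Longrightarrow> adjacent L A y x"
  by (auto simp: adjacent_def)

text \<open>The order of an induced cycle of length at least 4 never matters; only these properties of its vertex
  set are used.\<close>

definition hole :: "'l set \<Rightarrow> ('a, 'l) struct \<Rightarrow> 'a set \<Rightarrow> bool" where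
  "hole L A C \<longleftrightarrow> C \<subseteq> verts A \<and> finite C \<and> (\<exists>u\<in>C. \<exists>v\<in>C. adjacent L A u v) \<and>
    (\<forall>u\<in>C. \<exists>v\<in>C. u \<noteq> v \<and> \<not> adjacent L A u v) \<and>
    (\<forall>P. (\<forall>u v. adjacent L A u v \<longrightarrow> P u \<longrightarrow> P v) \<longrightarrow> (\<exists>u\<in>C. P u) \<longrightarrow> (\<forall>u\<in>C. P u))"

lemma holeD:
  assumes "hole L A C"
  shows "C \<subseteq> verts A" "finite C" "\<exists>u\<in>C. \<exists>v\<in>C. adjacent L A u v"
    "\<forall>u\<in>C. \<exists>v\<in>C. u \<noteq> v \<and> \<not> adjacent L A u v"
  using assms by (simp_all add: hole_def)

lemma hole_connected:
  assumes "hole L A C" "\<And>u v. adjacent L A u v \<Longrightarrow> P u \<Longrightarrow> P v" "u \<in> C" "P u" "v \<in> C"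
  shows "P v"
proof -
  have "\<forall>P. (\<forall>u v. adjacent L A u v \<longrightarrow> P u \<longrightarrow> P v) \<longrightarrow> (\<exists>u\<in>C. P u) \<longrightarrow> (\<forall>u\<in>C. P u)"
    using assms(1) unfolding hole_def by (elim conjE)
  from spec[OF this, of P] show ?thesis using assms(2-5) by blast
qed

text \<open>On an induced cycle of length at least 4 the vertex two places further on is a
  non-neighbour; the closure property in \<open>hole\<close> follows by walking along the
  cycle.\<close>

lemma induced_cycle_cases:
  assumes "induced_cycle L A vs"
  obtains a b c where "set vs = {a, b, c}" "adjacent L A a b" "adjacent L A b c" "adjacent L A a c"
  | "hole L A (set vs)"
proof -
  have len: "length vs \<ge> 3" and dist: "distinct vs" and sub: "set vs \<subseteq> verts A"
    and adj: "\<And>i. i + 1 < length vs \<Longrightarrow> adjacent L A (vs ! i) (vs ! (i + 1))"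
    and last: "adjacent L A (vs ! (length vs - 1)) (vs ! 0)"
    and ind: "\<And>i j. i < j \<Longrightarrow> j < length vs \<Longrightarrow> j \<noteq> i + 1 \<Longrightarrow> i \<noteq> 0 \<or> j \<noteq> length vs - 1 \<Longrightarrow>
      \<not> adjacent L A (vs ! i) (vs ! j)"
    using assms by (auto simp: induced_cycle_def is_cycle_def)
  show thesis
  proof (cases "length vs = 3")
    case True
    then obtain a b c where "vs = [a, b, c]" by (auto simp: length_Suc_conv numeral_3_eq_3)
    then show thesis using that(1)[of a b c] adj[of 0] adj[of 1] last
      by (auto intro: adjacent_sym)
  next
    case False
    then have len: "length vs \<ge> 4" using len by simp
    have nonadj: "\<exists>j<length vs. vs ! i \<noteq> vs ! j \<and> \<not> adjacent L A (vs ! i) (vs ! j)"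
      if i: "i < length vs" for i
    proof -
      consider "i + 2 < length vs" | "i = length vs - 2" | "i = length vs - 1" using i by linarith
      then show ?thesis
      proof cases
        case 1
        moreover have "i \<noteq> 0 \<or> i + 2 \<noteq> length vs - 1" using len by linarith
        ultimately have "\<not> adjacent L A (vs ! i) (vs ! (i + 2))" using ind[of i "i + 2"] by simp
        then show ?thesis using 1 i dist
          by (intro exI[of _ "i + 2"]) (simp add: nth_eq_iff_index_eq)
      next
        case 2
        then have i0: "0 < i" "i \<noteq> 0 + 1" "i \<noteq> length vs - 1" using len by linarith+
        then have "\<not> adjacent L A (vs ! 0) (vs ! i)" using ind[of 0 i] i by simp
        moreover have "vs ! i \<noteq> vs ! 0" using nth_eq_iff_index_eq[OF dist i, of 0] i0(1) i by linarith
        ultimately show ?thesis using i0(1) i by (intro exI[of _ 0]) (auto dest: adjacent_sym)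
      next
        case 3
        then have i0: "1 < i" "i \<noteq> 1 + 1" using len by linarith+
        then have "\<not> adjacent L A (vs ! 1) (vs ! i)" using ind[of 1 i] i by simp
        moreover have "vs ! i \<noteq> vs ! 1" using nth_eq_iff_index_eq[OF dist i, of 1] i0(1) i by linarith
        ultimately show ?thesis using i0(1) i by (intro exI[of _ 1]) (auto dest: adjacent_sym)
      qed
    qed
    have conn: "P (vs ! j)"
      if P: "\<And>u v. adjacent L A u v \<Longrightarrow> P u \<Longrightarrow> P v" and i: "i < length vs" "P (vs ! i)"
        and j: "j < length vs" for P i j
    proof -
      have "P (vs ! 0)" using i
      proof (induction i)
        case (Suc i)
        then show ?case using P[OF adjacent_sym[OF adj[of i]]] by simp
      qed
      then show ?thesis using j
      proof (induction j)
        case (Suc j)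
        then show ?case using P[OF adj[of j]] by simp
      qed
    qed
    have "hole L A (set vs)"
      unfolding hole_def
    proof (intro conjI allI impI ballI)
      show "\<exists>u\<in>set vs. \<exists>v\<in>set vs. adjacent L A u v"
      proof (intro bexI)
        show "adjacent L A (vs ! 0) (vs ! (0 + 1))" using len by (intro adj) linarith
      qed (rule nth_mem, use len in linarith)+
      show "\<exists>v\<in>set vs. u \<noteq> v \<and> \<not> adjacent L A u v" if "u \<in> set vs" for u
        using that nonadj by (metis in_set_conv_nth)
      show "P u" if "\<forall>u v. adjacent L A u v \<longrightarrow> P u \<longrightarrow> P v" "\<exists>u\<in>set vs. P u" "u \<in> set vs" for P u
        using that conn[of P] by (metis in_set_conv_nth)
    qed (use sub in auto)
    then show thesis by (rule that(2))
  qed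
qed

section \<open>Completions to \<open>K\<close> in terms of edge labels\<close>

locale cycle_completion =
  fixes L :: "'l set" and ar :: "'l \<Rightarrow> nat" and K :: "('a, 'l) struct"
  assumes finite_L: "finite L"
    and arity: "\<forall>R\<in>L. ar R = 1 \<or> ar R = 2"
    and K: "L_structure L ar K"
    and countable_K: "countable (verts K)" and infinite_K: "infinite (verts K)"
    and irreducible_K: "irreducible_struct L K"
    and cycle_completion: "\<And>A :: (nat, 'l) struct.
           L_structure L ar A \<Longrightarrow>
           countable (verts A) \<Longrightarrow>
           (\<And>vs. induced_cycle L A vs \<Longrightarrow> has_completion L (induced_sub A (set vs)) K) \<Longrightarrow>
           (\<And>S. S \<subseteq> verts A \<Longrightarrow> finite S \<Longrightarrow> card S \<le> 2 \<Longrightarrow>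
                 irreducible_struct L (induced_sub A S) \<Longrightarrow> embeds L (induced_sub A S) K) \<Longrightarrow>
           has_completion L A K"
begin

definition eK :: "'a \<Rightarrow> 'a \<Rightarrow> 'l set" where
  "eK = edge L ar K"

text \<open>For such labels \<open>of_edge\<close> loses nothing: \<open>edge\<close> recovers
  \<open>e\<close> on \<open>V\<close>.\<close>

definition valid :: "'v set \<Rightarrow> ('v \<Rightarrow> 'v \<Rightarrow> 'l set) \<Rightarrow> bool" where
  "valid V e \<longleftrightarrow> (\<forall>x\<in>V. \<forall>y\<in>V. e x y \<subseteq> L \<and> (x \<noteq> y \<longrightarrow> (\<forall>R\<in>e x y. ar R = 2)))"

definition adj :: "('v \<Rightarrow> 'v \<Rightarrow> 'l set) \<Rightarrow> 'v \<Rightarrow> 'v \<Rightarrow> bool" where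
  "adj e x y \<longleftrightarrow> x \<noteq> y \<and> e x y \<union> e y x \<noteq> {}"

definition fits :: "'v set \<Rightarrow> ('v \<Rightarrow> 'v \<Rightarrow> 'l set) \<Rightarrow> ('v \<Rightarrow> 'a) \<Rightarrow> bool" where
  "fits V e f \<longleftrightarrow> f \<in> V \<rightarrow> verts K \<and> inj_on f V \<and> (\<forall>x\<in>V. eK (f x) (f x) = e x x) \<and>
    (\<forall>x\<in>V. \<forall>y\<in>V. adj e x y \<longrightarrow> eK (f x) (f y) = e x y)"

lemma fits_subset: "fits V e f \<Longrightarrow> W \<subseteq> V \<Longrightarrow> fits W e f"
  unfolding fits_def by (blast intro: inj_on_subset)

lemma eK_valid: "eK x y \<subseteq> L" "x \<noteq> y \<Longrightarrow> R \<in> eK x y \<Longrightarrow> ar R = 2"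
  by (auto simp: eK_def edge_def)

lemma eK_nonempty: "x \<in> verts K \<Longrightarrow> y \<in> verts K \<Longrightarrow> x \<noteq> y \<Longrightarrow> eK x y \<union> eK y x \<noteq> {}"
  using irreducible_K by (simp add: irreducible_struct_def eK_def adjacent_iff_edge[OF K])

lemma edge_valid:
  "valid V e \<Longrightarrow> x \<in> V \<Longrightarrow> y \<in> V \<Longrightarrow> edge L ar (of_edge ar V e) x y = e x y"
  by (rule edge_of_edge[OF arity]) (auto simp: valid_def)

lemma adjacent_valid:
  "valid V e \<Longrightarrow> adjacent L (of_edge ar V e) x y \<longleftrightarrow> x \<in> V \<and> y \<in> V \<and> adj e x y"
  by (auto simp: adjacent_iff_edge[OF L_structure_of_edge] edge_valid adj_def)

lemma completion_iff_fits:
  assumes "valid V e" "S \<subseteq> V"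
  shows "completion L f (induced_sub (of_edge ar V e) S) K \<longleftrightarrow> fits S e f"
proof -
  let ?A = "induced_sub (of_edge ar V e) S"
  have A: "L_structure L ar ?A" by (intro L_structure_induced_sub L_structure_of_edge)
  have e: "edge L ar ?A x y = e x y" if "x \<in> S" "y \<in> S" for x y
  proof -
    have "x \<in> V" "y \<in> V" using that assms(2) by auto
    then show ?thesis using that by (simp only: edge_induced_sub edge_valid[OF assms(1)])
  qed
  have adjA: "adjacent L ?A x y \<longleftrightarrow> x \<in> S \<and> y \<in> S \<and> adj e x y" for x y
    by (auto simp: adjacent_iff_edge[OF A] e adj_def)
  have "f x \<noteq> f y" if "inj_on f S" "x \<in> S" "y \<in> S" "adj e x y" for x y
    using that by (auto simp: inj_on_def adj_def)
  moreover have "completion L f ?A K \<longleftrightarrow> (f \<in> S \<rightarrow> verts K \<and> (\<forall>x\<in>S. eK (f x) (f x) = e x x) \<and>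
      (\<forall>x\<in>S. \<forall>y\<in>S. adj e x y \<longrightarrow> f x \<noteq> f y \<and> eK (f x) (f y) = e x y)) \<and> inj_on f S"
    unfolding completion_def hom_embedding_iff_edge[OF A K arity] adjA verts_induced_sub
    using e irreducible_K by (simp add: eK_def Ball_def) blast
  ultimately show ?thesis
    unfolding fits_def by blast
qed

text \<open>The completion hypothesis speaks of structures on \<open>nat\<close>, to which the
  labels are carried by an enumeration of \<open>V\<close>; its induced cycles are triangles or
  holes by \<open>induced_cycle_cases\<close>.\<close>

lemma completion_exists:
  fixes V :: "'v set"
  assumes V: "countable V" and e: "valid V e"
    and hole: "\<And>C. hole L (of_edge ar V e) C \<Longrightarrow> \<exists>f. fits C e f"
    and tri: "\<And>a b c. a \<in> V \<Longrightarrow> b \<in> V \<Longrightarrow> c \<in> V \<Longrightarrow> adj e a b \<Longrightarrow> adj e b c \<Longrightarrow> adj e a c \<Longrightarrow>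
      \<exists>f. fits {a, b, c} e f"
    and small: "\<And>a b. a \<in> V \<Longrightarrow> b \<in> V \<Longrightarrow> a = b \<or> adj e a b \<Longrightarrow> \<exists>f. fits {a, b} e f"
  obtains f where "fits V e f"
proof -
  define g where "g = to_nat_on V"
  have g: "inj_on g V" using V unfolding g_def by (rule inj_on_to_nat_on)
  define h where "h = inv_into V g"
  have hg: "h (g x) = x" if "x \<in> V" for x using that g by (simp add: h_def)
  define V' where "V' = g ` V"
  have hV: "h i \<in> V" "g (h i) = i" if "i \<in> V'" for i using that hg by (auto simp: V'_def)
  define e' where "e' i j = e (h i) (h j)" for i j
  have inj_h: "inj_on h V'" using hV by (metis inj_on_def)
  have h_eq: "h i = h j \<longleftrightarrow> i = j" if "i \<in> V'" "j \<in> V'" for i j using hV that by metis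
  have e': "valid V' e'"
    unfolding valid_def
  proof (intro ballI)
    fix i j assume ij: "i \<in> V'" "j \<in> V'"
    have "e (h i) (h j) \<subseteq> L \<and> (h i \<noteq> h j \<longrightarrow> (\<forall>R\<in>e (h i) (h j). ar R = 2))"
      using e hV(1)[OF ij(1)] hV(1)[OF ij(2)] unfolding valid_def by blast
    then show "e' i j \<subseteq> L \<and> (i \<noteq> j \<longrightarrow> (\<forall>R\<in>e' i j. ar R = 2))"
      by (simp add: h_eq[OF ij] e'_def)
  qed
  have adj': "adj e' i j \<longleftrightarrow> adj e (h i) (h j)" if "i \<in> V'" "j \<in> V'" for i j
    using h_eq[OF that] by (simp add: adj_def e'_def)
  have fits': "fits S e' (f \<circ> h)" if S: "S \<subseteq> V'" and f: "fits (h ` S) e f" for S f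
  proof -
    have "inj_on (f \<circ> h) S"
      using f inj_on_subset[OF inj_h S] by (intro comp_inj_on) (auto simp: fits_def)
    then show ?thesis using f S adj' unfolding fits_def
      by (auto simp: e'_def subset_iff)
  qed
  let ?A = "of_edge ar V' e'"
  have "has_completion L ?A K"
  proof (rule cycle_completion)
    show "L_structure L ar ?A" by (rule L_structure_of_edge)
    show "countable (verts ?A)" by simp
  next
    fix vs assume c: "induced_cycle L ?A vs"
    then have vs: "set vs \<subseteq> V'" by (auto simp: induced_cycle_def is_cycle_def)
    have nth: "vs ! i \<in> V'" if "i < length vs" for i using vs that by auto
    have "adjacent L ?A (vs ! i) (vs ! j) \<longleftrightarrow> adjacent L (of_edge ar V e) (map h vs ! i) (map h vs ! j)"
      if "i < length vs" "j < length vs" for i j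
      using that nth hV(1) by (simp add: adjacent_valid[OF e] adjacent_valid[OF e'] adj')
    moreover have "distinct (map h vs) \<longleftrightarrow> distinct vs"
      using inj_on_subset[OF inj_h vs] by (simp add: distinct_map)
    moreover have "h ` set vs \<subseteq> V" using vs hV(1) by auto
    moreover have "vs \<noteq> []" using c by (auto simp: induced_cycle_def is_cycle_def)
    ultimately have "induced_cycle L (of_edge ar V e) (map h vs)"
      using c unfolding induced_cycle_def is_cycle_def by (auto simp: nth_map)
    then have "\<exists>f. fits (set (map h vs)) e f"
    proof (cases rule: induced_cycle_cases)
      case (1 a b c)
      then show ?thesis using tri[of a b c] by (simp add: adjacent_valid[OF e])
    qed (use hole in auto)
    then obtain f where "fits (h ` set vs) e f" by auto
    then have "fits (set vs) e' (f \<circ> h)" by (rule fits'[OF vs])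
    then show "has_completion L (induced_sub ?A (set vs)) K"
      unfolding has_completion_def completion_iff_fits[OF e' vs] by blast
  next
    fix S assume S: "S \<subseteq> verts ?A" "finite S" "card S \<le> 2"
      and irr: "irreducible_struct L (induced_sub ?A S)"
    have SV: "S \<subseteq> V'" using S by simp
    have A: "L_structure L ar (induced_sub ?A S)"
      by (intro L_structure_induced_sub L_structure_of_edge)
    have adjS: "adj e' x y" if "x \<in> S" "y \<in> S" "x \<noteq> y" for x y
    proof -
      have "adjacent L (induced_sub ?A S) x y" using irr that by (simp add: irreducible_struct_def)
      then have "edge L ar ?A x y \<union> edge L ar ?A y x \<noteq> {}"
        using that by (simp add: adjacent_iff_edge[OF A] edge_induced_sub)
      moreover have "edge L ar ?A x y = e' x y" "edge L ar ?A y x = e' y x"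
        using that SV by (auto intro!: edge_valid[OF e'])
      ultimately show ?thesis using that by (simp add: adj_def)
    qed
    have "\<exists>f. fits (h ` S) e f"
    proof (cases "S = {}")
      case True
      then show ?thesis by (simp add: fits_def)
    next
      case False
      then have "card S = 1 \<or> card S = 2" using S(2,3) by (cases "card S") auto
      then obtain x y where xy: "S = {x, y}" by (metis card_1_singletonE card_2_iff insert_absorb2)
      then show ?thesis using small[of "h x" "h y"] adjS[of x y] adj'[of x y] SV hV(1) by auto
    qed
    then obtain f where "fits S e' (f \<circ> h)" using fits'[OF SV] by blast
    then have "completion L (f \<circ> h) (induced_sub ?A S) K"
      by (simp add: completion_iff_fits[OF e' SV])
    moreover have "induced_sub (induced_sub ?A S) S = induced_sub ?A S"
      by (auto simp: induced_sub_def)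
    ultimately have "embedding L (f \<circ> h) (induced_sub ?A S) K"
      using irr unfolding completion_def hom_embedding_def verts_induced_sub by (metis order_refl)
    then show "embeds L (induced_sub ?A S) K" by (auto simp: embeds_def)
  qed
  moreover have "induced_sub ?A V' = ?A" by (auto simp: induced_sub_def of_edge_def fun_eq_iff)
  ultimately obtain f where f: "fits V' e' f"
    using completion_iff_fits[OF e' order_refl] by (auto simp: has_completion_def)
  have gV: "g x \<in> V'" if "x \<in> V" for x using that by (simp add: V'_def)
  have "inj_on (f \<circ> g) V" using f g by (intro comp_inj_on) (auto simp: fits_def V'_def)
  moreover have "adj e' (g x) (g y) \<longleftrightarrow> adj e x y" "e' (g x) (g y) = e x y" if "x \<in> V" "y \<in> V" for x y
    using adj'[of "g x" "g y"] that by (simp_all add: gV hg e'_def)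
  ultimately have "fits V e (f \<circ> g)"
    using f unfolding fits_def by (auto simp: gV)
  then show thesis by (rule that)
qed

subsection \<open>A structure on words containing the given structure\<close>

definition tp :: "'a \<Rightarrow> 'a \<Rightarrow> 'l set \<times> 'l set \<times> 'l set \<times> 'l set" where
  "tp x y = (eK x x, eK x y, eK y x, eK y y)"

definition types :: "('l set \<times> 'l set \<times> 'l set \<times> 'l set) set" where
  "types = {tp x y | x y. x \<in> verts K \<and> y \<in> verts K \<and> x \<noteq> y}"

abbreviation src :: "'b \<times> 'b \<times> 'b \<times> 'b \<Rightarrow> 'b" where "src u \<equiv> fst u"
abbreviation fwd :: "'b \<times> 'b \<times> 'b \<times> 'b \<Rightarrow> 'b" where "fwd u \<equiv> fst (snd u)"
abbreviation bwd :: "'b \<times> 'b \<times> 'b \<times> 'b \<Rightarrow> 'b" where "bwd u \<equiv> fst (snd (snd u))"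
abbreviation tgt :: "'b \<times> 'b \<times> 'b \<times> 'b \<Rightarrow> 'b" where "tgt u \<equiv> snd (snd (snd u))"

lemma finite_types: "finite types"
proof (rule finite_subset)
  show "types \<subseteq> Pow L \<times> Pow L \<times> Pow L \<times> Pow L"
    unfolding types_def tp_def by (auto dest: subsetD[OF eK_valid(1)])
qed (use finite_L in auto)

text \<open>A vertex is a pair of a loop type and a word; the letter at position \<open>i\<close> is the type of the
  pair formed by a vertex of level \<open>i\<close> and the given one. A vertex \<open>p\<close> is joined to a vertex \<open>q\<close>
  of a higher level as prescribed by the letter of \<open>q\<close> at the level of \<open>p\<close>, unless this contradicts
  the existence of common neighbours at some level below \<open>p\<close>.\<close>

definition GV :: "('l set \<times> ('l set \<times> 'l set \<times> 'l set \<times> 'l set) list) set" where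
  "GV = {p. fst p \<in> (\<lambda>x. eK x x) ` verts K \<and> (\<forall>u\<in>set (snd p). u \<in> types \<and> tgt u = fst p)}"

abbreviation level :: "'b \<times> 'c list \<Rightarrow> nat" where "level p \<equiv> length (snd p)"

definition link where
  "link p q \<longleftrightarrow> level p < level q \<and> src (snd q ! level p) = fst p \<and>
    (\<forall>i < level p. \<exists>a\<in>verts K. \<exists>b\<in>verts K. \<exists>c\<in>verts K. a \<noteq> b \<and> a \<noteq> c \<and> b \<noteq> c \<and>
       tp a b = snd p ! i \<and> tp a c = snd q ! i \<and> tp b c = snd q ! level p)"

definition eG where
  "eG p q = (if p = q then fst p else if link p q then fwd (snd q ! level p)
     else if link q p then bwd (snd p ! level q) else {})"

lemma link_level: "link p q \<Longrightarrow> level p < level q"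
  by (simp add: link_def)

lemma eG_link:
  assumes "link p q"
  shows "eG p q = fwd (snd q ! level p)" "eG q p = bwd (snd q ! level p)" "p \<noteq> q"
  using assms link_level[of q p] link_level[OF assms] by (auto simp: eG_def)

lemma eG_diag: "eG p p = fst p"
  by (simp add: eG_def)

lemma adj_eG: "adj eG p q \<Longrightarrow> link p q \<or> link q p"
  by (auto simp: adj_def eG_def split: if_splits)

lemma adj_sym: "adj e x y \<longleftrightarrow> adj e y x"
  by (auto simp: adj_def)

lemma letter_type:
  assumes "q \<in> GV" "i < level q"
  obtains a b where "a \<in> verts K" "b \<in> verts K" "a \<noteq> b" "snd q ! i = tp a b" "eK b b = fst q"
proof -
  have "snd q ! i \<in> types" "tgt (snd q ! i) = fst q"
    using assms nth_mem[of i "snd q"] by (auto simp: GV_def)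
  then show thesis using that by (auto simp: types_def tp_def)
qed

lemma valid_eG: "valid GV eG"
  unfolding valid_def
proof (intro ballI)
  fix p q assume p: "p \<in> GV" "q \<in> GV"
  have *: "fwd (snd q ! level p) \<subseteq> L \<and> bwd (snd q ! level p) \<subseteq> L \<and>
    (\<forall>R\<in>fwd (snd q ! level p). ar R = 2) \<and> (\<forall>R\<in>bwd (snd q ! level p). ar R = 2)"
    if link: "link p q" and q: "q \<in> GV" for p q
  proof -
    obtain a b where "a \<in> verts K" "b \<in> verts K" "a \<noteq> b" "snd q ! level p = tp a b" "eK b b = fst q"
      by (rule letter_type[OF q link_level[OF link]])
    then show ?thesis using eK_valid(1) eK_valid(2)[of a b] eK_valid(2)[of b a] by (simp add: tp_def)
  qed
  have "fst p \<subseteq> L" using p(1) by (auto simp: GV_def dest: subsetD[OF eK_valid(1)])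
  then show "eG p q \<subseteq> L \<and> (p \<noteq> q \<longrightarrow> (\<forall>R\<in>eG p q. ar R = 2))"
    using *[OF _ p(2), of p] *[OF _ p(1), of q] by (cases "p = q") (simp_all add: eG_def)
qed

section \<open>Completions of finite substructures of the structure on words\<close>

lemma fits_triangle:
  assumes d: "x \<noteq> y" "x \<noteq> z" "y \<noteq> z"
    and a: "a \<in> verts K" "b \<in> verts K" "c \<in> verts K" "a \<noteq> b" "a \<noteq> c" "b \<noteq> c"
    and e: "e x x = eK a a" "e y y = eK b b" "e z z = eK c c" "e x y = eK a b" "e y x = eK b a"
      "e x z = eK a c" "e z x = eK c a" "e y z = eK b c" "e z y = eK c b"
  shows "\<exists>f. fits {x, y, z} e f"
proof
  show "fits {x, y, z} e (\<lambda>v. if v = x then a else if v = y then b else c)"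
    unfolding fits_def using d a e by (auto simp: inj_on_def)
qed

lemma fits_pair:
  assumes "x \<noteq> y" and a: "a \<in> verts K" "b \<in> verts K" "a \<noteq> b"
    and e: "e x x = eK a a" "e y y = eK b b" "e x y = eK a b" "e y x = eK b a"
  shows "\<exists>f. fits {x, y} e f"
proof
  show "fits {x, y} e (\<lambda>v. if v = x then a else b)"
    unfolding fits_def using assms by (auto simp: inj_on_def)
qed

lemma fits_single: "a \<in> verts K \<Longrightarrow> e x x = eK a a \<Longrightarrow> \<exists>f. fits {x, x} e f"
  by (rule exI[of _ "\<lambda>_. a"]) (simp add: fits_def adj_def)

lemma fits_cong:
  assumes "fits V e f" "\<And>x. x \<in> V \<Longrightarrow> e' x x = e x x"
    "\<And>x y. x \<in> V \<Longrightarrow> y \<in> V \<Longrightarrow> adj e' x y \<Longrightarrow> adj e x y \<and> e' x y = e x y"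
  shows "fits V e' f"
  using assms unfolding fits_def by simp

text \<open>For every loop type \<open>l \<in> \<Lambda>\<close> a new vertex \<open>Inl l\<close> is joined to \<open>F\<close> as prescribed by the letters at
  position \<open>m\<close>. The source of that letter is constant along edges, so a long induced cycle through \<open>Inl l\<close>
  would only have vertices adjacent to \<open>Inl l\<close>.\<close>

lemma fits_cone:
  assumes F: "F \<subseteq> GV" "finite F" and m: "\<And>p. p \<in> F \<Longrightarrow> m < level p"
    and fF: "fits F eG fF" and \<Lambda>: "\<Lambda> \<subseteq> (\<lambda>x. eK x x) ` verts K" "finite \<Lambda>"
  obtains g h where "g \<in> \<Lambda> \<rightarrow> verts K" "h \<in> F \<rightarrow> verts K" "inj_on h F" "\<forall>l\<in>\<Lambda>. eK (g l) (g l) = l"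
    "\<forall>p\<in>F. eK (h p) (h p) = fst p" "\<forall>l\<in>\<Lambda>. \<forall>p\<in>F. g l \<noteq> h p"
    "\<forall>p\<in>F. \<forall>q\<in>F. adj eG p q \<longrightarrow> eK (h p) (h q) = eG p q"
    "\<forall>l\<in>\<Lambda>. \<forall>p\<in>F. src (snd p ! m) = l \<longrightarrow>
       eK (g l) (h p) = fwd (snd p ! m) \<and> eK (h p) (g l) = bwd (snd p ! m)"
proof -
  define e where "e x y = (case (x, y) of
      (Inl l, Inl l') \<Rightarrow> if l = l' then l else {}
    | (Inl l, Inr p) \<Rightarrow> if src (snd p ! m) = l then fwd (snd p ! m) else {}
    | (Inr p, Inl l) \<Rightarrow> if src (snd p ! m) = l then bwd (snd p ! m) else {}
    | (Inr p, Inr q) \<Rightarrow> eG p q)" for x y :: "'l set + 'l set \<times> ('l set \<times> 'l set \<times> 'l set \<times> 'l set) list"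
  have e_simps [simp]: "e (Inl l) (Inl l') = (if l = l' then l else {})"
    "e (Inl l) (Inr p) = (if src (snd p ! m) = l then fwd (snd p ! m) else {})"
    "e (Inr p) (Inl l) = (if src (snd p ! m) = l then bwd (snd p ! m) else {})"
    "e (Inr p) (Inr q) = eG p q" for l l' p q by (simp_all add: e_def)
  let ?V = "Inl ` \<Lambda> \<union> Inr ` F"
  have letter: "\<exists>a\<in>verts K. \<exists>b\<in>verts K. a \<noteq> b \<and> snd p ! m = tp a b \<and> eK b b = fst p" if pF: "p \<in> F" for p
  proof -
    have p: "p \<in> GV" using F(1) pF by blast
    obtain a b where "a \<in> verts K" "b \<in> verts K" "a \<noteq> b" "snd p ! m = tp a b" "eK b b = fst p"
      by (rule letter_type[OF p m[OF pF]])
    then show ?thesis by blast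
  qed
  have letter_tgt: "tgt (snd p ! m) = fst p" if "p \<in> F" for p
    using letter[OF that] by (elim bexE conjE) (simp add: tp_def)
  have \<Lambda>L: "l \<subseteq> L" if "l \<in> \<Lambda>" for l using \<Lambda>(1) that by (auto dest: subsetD[OF eK_valid(1)])
  have letter_valid: "fwd (snd p ! m) \<subseteq> L \<and> bwd (snd p ! m) \<subseteq> L \<and>
    (\<forall>R\<in>fwd (snd p ! m). ar R = 2) \<and> (\<forall>R\<in>bwd (snd p ! m). ar R = 2)" if p: "p \<in> F" for p
  proof -
    obtain a b where "a \<noteq> b" "snd p ! m = tp a b" using letter[OF p] by blast
    then show ?thesis using eK_valid(1) eK_valid(2)[of a b] eK_valid(2)[of b a] by (simp add: tp_def)
  qed
  have valid: "valid ?V e"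
    unfolding valid_def
  proof (intro ballI)
    fix x y assume xy: "x \<in> ?V" "y \<in> ?V"
    show "e x y \<subseteq> L \<and> (x \<noteq> y \<longrightarrow> (\<forall>R\<in>e x y. ar R = 2))"
    proof (cases x; cases y)
      fix l l' assume x: "x = Inl l" "y = Inl l'"
      then have "l \<in> \<Lambda>" using xy by blast
      then show ?thesis using \<Lambda>L[of l] x by auto
    next
      fix l p assume x: "x = Inl l" "y = Inr p"
      then have "p \<in> F" using xy by blast
      then show ?thesis using letter_valid x by simp
    next
      fix p l assume x: "x = Inr p" "y = Inl l"
      then have "p \<in> F" using xy by blast
      then show ?thesis using letter_valid x by simp
    next
      fix p q assume x: "x = Inr p" "y = Inr q"
      then have "p \<in> GV" "q \<in> GV" using xy F(1) by blast+
      then show ?thesis using x valid_eG unfolding valid_def by simp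
    qed
  qed
  define col where "col x = (case x of Inl l \<Rightarrow> l | Inr p \<Rightarrow> src (snd p ! m))"
    for x :: "'l set + 'l set \<times> ('l set \<times> 'l set \<times> 'l set \<times> 'l set) list"
  have col_simps [simp]: "col (Inl l) = l" "col (Inr p) = src (snd p ! m)" for l p
    by (simp_all add: col_def)
  have tri_link: "\<exists>a\<in>verts K. \<exists>b\<in>verts K. \<exists>c\<in>verts K. a \<noteq> b \<and> a \<noteq> c \<and> b \<noteq> c \<and>
       tp a b = snd p ! m \<and> tp a c = snd q ! m \<and> tp b c = snd q ! level p"
    if "link p q" "p \<in> F" for p q using that m[of p] unfolding link_def by blast
  have col_link: "src (snd p ! m) = src (snd q ! m)" if "link p q" "p \<in> F" for p q
    using tri_link[OF that] by (metis fst_conv tp_def)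
  have col_adj: "col x = col y" if "x \<in> ?V" "y \<in> ?V" "adj e x y" for x y
  proof (cases x; cases y)
    fix p q assume pq: "x = Inr p" "y = Inr q"
    then have "adj eG p q" using that(3) by (simp add: adj_def)
    then show ?thesis using adj_eG[of p q] col_link[of p q] col_link[of q p] pq that by auto
  qed (use that in \<open>auto simp: adj_def split: if_splits\<close>)
  \<comment> \<open>The clause of \<open>link\<close> at \<open>i = m\<close> supplies this
    triangle, with the common neighbour \<open>a\<close> as the image of
    \<open>Inl l\<close>.\<close>
  have cone: "\<exists>f. fits {Inl l, Inr p, Inr q} e f"
    if pq: "link p q" "p \<in> F" "q \<in> F" "src (snd p ! m) = l" for l p q
  proof -
    obtain a b c where a: "a \<in> verts K" "b \<in> verts K" "c \<in> verts K" "a \<noteq> b" "a \<noteq> c" "b \<noteq> c"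
       "tp a b = snd p ! m" "tp a c = snd q ! m" "tp b c = snd q ! level p"
      using tri_link[OF pq(1,2)] by blast
    have "eK b b = fst p" using letter_tgt[OF pq(2)] unfolding a(7)[symmetric] by (simp add: tp_def)
    moreover have "eK c c = fst q" using letter_tgt[OF pq(3)] unfolding a(8)[symmetric] by (simp add: tp_def)
    moreover have "eK a a = l" using pq(4) unfolding a(7)[symmetric] by (simp add: tp_def)
    ultimately show ?thesis
      using eG_link[OF pq(1)]
      by (intro fits_triangle[OF _ _ _ a(1-6)])
        (simp_all add: a(7-9)[symmetric] tp_def eG_diag)
  qed
  have cone': "\<exists>f. fits {Inl l, Inr p, Inr q} e f"
    if "p \<in> F" "q \<in> F" "adj e (Inl l) (Inr p)" "adj e (Inl l) (Inr q)" "adj e (Inr p) (Inr q)" for l p q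
  proof -
    have l: "src (snd p ! m) = l" "src (snd q ! m) = l"
      using that(3,4) by (auto simp: adj_def split: if_splits)
    have "adj eG p q" using that(5) by (simp add: adj_def)
    then consider "link p q" | "link q p" using adj_eG by blast
    then show ?thesis
    proof cases
      case 2
      then show ?thesis using cone[OF 2 that(2,1) l(2)] by (simp add: insert_commute)
    qed (use cone that l in blast)
  qed
  have base: "\<exists>f. fits C e f" if "C \<subseteq> Inr ` F" for C
  proof -
    have "fits (Inr ` F) e (fF \<circ> projr)"
      using fF unfolding fits_def by (auto simp: inj_on_def adj_def)
    then show ?thesis using fits_subset that by blast
  qed
  have Inl_nonadj: "\<not> adj e (Inl l) (Inl l')" for l l' by (simp add: adj_def)
  obtain f where f: "fits ?V e f"
  proof (rule completion_exists[of ?V e])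
    show "countable ?V" using F(2) \<Lambda>(2) by (simp add: countable_finite)
    show "valid ?V e" by (rule valid)
  next
    fix C assume C: "hole L (of_edge ar ?V e) C"
    have CV: "C \<subseteq> ?V" using holeD(1)[OF C] by simp
    show "\<exists>f. fits C e f"
    proof (cases "C \<subseteq> Inr ` F")
      case False
      then obtain x where "x \<in> C" "x \<notin> Inr ` F" by blast
      then obtain l where l: "Inl l \<in> C" "l \<in> \<Lambda>" using CV by blast
      \<comment> \<open>Connectedness gives this non-neighbour \<open>x\<close> the source
        \<open>l\<close>, so it is some \<open>Inr p\<close> whose letter at \<open>m\<close> starts
        in \<open>l\<close>. As \<open>K\<close> is irreducible, that letter has a nonempty label,
        which makes \<open>x\<close> adjacent to \<open>Inl l\<close>.\<close>
      obtain x where x: "x \<in> C" "Inl l \<noteq> x" "\<not> adjacent L (of_edge ar ?V e) (Inl l) x"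
        using bspec[OF holeD(4)[OF C] l(1)] by blast
      have "col x = l"
      proof (rule hole_connected[OF C _ l(1) _ x(1), of "\<lambda>x. col x = l"])
        show "col v = l" if "adjacent L (of_edge ar ?V e) u v" "col u = l" for u v
          using that col_adj[of u v] by (simp add: adjacent_valid[OF valid])
      qed simp
      then obtain p where p: "x = Inr p" "p \<in> F" "src (snd p ! m) = l"
      proof (cases x)
        case (Inr p)
        then show ?thesis using that[of p] x(1) CV \<open>col x = l\<close> by auto
      qed (use x(2) in simp)
      obtain a b where ab: "a \<in> verts K" "b \<in> verts K" "a \<noteq> b" "snd p ! m = tp a b"
        using letter[OF p(2)] by blast
      then have "adj e (Inl l) x" using p eK_nonempty[OF ab(1-3)] by (simp add: adj_def tp_def)
      then show ?thesis using x p l by (simp add: adjacent_valid[OF valid])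
    qed (rule base)
  next
    fix x y z assume V: "x \<in> ?V" "y \<in> ?V" "z \<in> ?V" and adj: "adj e x y" "adj e y z" "adj e x z"
    show "\<exists>f. fits {x, y, z} e f"
    proof (cases x)
      case x: (Inl l)
      then obtain p q where "y = Inr p" "z = Inr q" using adj Inl_nonadj by (metis old.sum.exhaust)
      then show ?thesis using cone'[of p q l] V adj x by auto
    next
      case x: (Inr p)
      show ?thesis
      proof (cases y)
        case y: (Inl l)
        then obtain q where "z = Inr q" using adj Inl_nonadj by (metis old.sum.exhaust)
        then show ?thesis using cone'[of p q l] V adj x y adj_sym[of e x y]
          by (auto simp: insert_commute)
      next
        case y: (Inr q)
        show ?thesis
        proof (cases z)
          case z: (Inl l)
          then show ?thesis using cone'[of p q l] V adj x y adj_sym[of e x z] adj_sym[of e y z]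
            by (auto simp: insert_commute)
        next
          case (Inr r)
          then show ?thesis using V x y by (intro base) auto
        qed
      qed
    qed
  next
    fix x y assume V: "x \<in> ?V" "y \<in> ?V" and adj: "x = y \<or> adj e x y"
    have mixed: "\<exists>f. fits {Inl l, Inr p} e f" if p: "p \<in> F" "adj e (Inl l) (Inr p)" for l p
    proof -
      have l: "src (snd p ! m) = l" using p(2) by (auto simp: adj_def split: if_splits)
      obtain a b where ab: "a \<in> verts K" "b \<in> verts K" "a \<noteq> b" "snd p ! m = tp a b" "eK b b = fst p"
        using letter[OF p(1)] by blast
      then show ?thesis using l by (intro fits_pair[OF _ ab(1-3)]) (auto simp: tp_def eG_diag)
    qed
    show "\<exists>f. fits {x, y} e f"
    proof (cases x)
      case x: (Inl l)
      show ?thesis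
      proof (cases y)
        case y: (Inl l')
        then have "x = y" using adj x Inl_nonadj by blast
        moreover obtain a where a: "a \<in> verts K" "l = eK a a" using V x \<Lambda>(1) by auto
        have "\<exists>f. fits {x, x} e f" by (rule fits_single[OF a(1)]) (simp add: x a(2))
        ultimately show ?thesis by simp
      next
        case (Inr p)
        then show ?thesis using mixed[of p l] V adj x by auto
      qed
    next
      case x: (Inr p)
      show ?thesis
      proof (cases y)
        case (Inl l)
        then show ?thesis using mixed[of p l] V adj x adj_sym[of e x y] by (auto simp: insert_commute)
      next
        case (Inr q)
        then show ?thesis using V x by (intro base) auto
      qed
    qed
  qed
  have fV: "f x \<in> verts K" if "x \<in> ?V" for x using f that by (auto simp: fits_def)
  have finj: "f x = f y \<longleftrightarrow> x = y" if "x \<in> ?V" "y \<in> ?V" for x y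
    using f that unfolding fits_def by (metis inj_on_eq_iff)
  have fd: "eK (f x) (f x) = e x x" if "x \<in> ?V" for x using f that unfolding fits_def by blast
  have fe: "eK (f x) (f y) = e x y" if "x \<in> ?V" "y \<in> ?V" "adj e x y" for x y
    using f that unfolding fits_def by blast
  show thesis
  proof (rule that[of "f \<circ> Inl" "f \<circ> Inr"])
    show "f \<circ> Inl \<in> \<Lambda> \<rightarrow> verts K" "f \<circ> Inr \<in> F \<rightarrow> verts K" using fV by auto
    show "inj_on (f \<circ> Inr) F" using finj by (auto simp: inj_on_def)
    show "\<forall>l\<in>\<Lambda>. eK ((f \<circ> Inl) l) ((f \<circ> Inl) l) = l" using fd by simp
    show "\<forall>p\<in>F. eK ((f \<circ> Inr) p) ((f \<circ> Inr) p) = fst p" using fd by (simp add: eG_diag)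
    show "\<forall>l\<in>\<Lambda>. \<forall>p\<in>F. (f \<circ> Inl) l \<noteq> (f \<circ> Inr) p" using finj by simp
    have "adj e (Inr p) (Inr q) \<longleftrightarrow> adj eG p q" for p q by (simp add: adj_def)
    then show "\<forall>p\<in>F. \<forall>q\<in>F. adj eG p q \<longrightarrow> eK ((f \<circ> Inr) p) ((f \<circ> Inr) q) = eG p q"
      using fe by simp
    have "eK (f (Inl l)) (f (Inr p)) = fwd (snd p ! m) \<and> eK (f (Inr p)) (f (Inl l)) = bwd (snd p ! m)"
      if l: "l \<in> \<Lambda>" "p \<in> F" "src (snd p ! m) = l" for l p
    proof -
      obtain a b where ab: "a \<in> verts K" "b \<in> verts K" "a \<noteq> b" "snd p ! m = tp a b"
        using letter[OF l(2)] by blast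
      have "adj e (Inl l) (Inr p)" "adj e (Inr p) (Inl l)"
        using eK_nonempty[OF ab(1-3)] ab(4) l(3) by (auto simp: adj_def tp_def)
      then show ?thesis using fe[of "Inl l" "Inr p"] fe[of "Inr p" "Inl l"] l by simp
    qed
    then show "\<forall>l\<in>\<Lambda>. \<forall>p\<in>F. src (snd p ! m) = l \<longrightarrow>
        eK ((f \<circ> Inl) l) ((f \<circ> Inr) p) = fwd (snd p ! m) \<and> eK ((f \<circ> Inr) p) ((f \<circ> Inl) l) = bwd (snd p ! m)"
      by simp
  qed
qed

text \<open>The induction removes the set \<open>T\<close> of vertices of minimal level. They have
  no edges among themselves because links raise the level, so one vertex of \<open>K\<close> per
  loop type first stands for all of them, and a second completion separates them.\<close>

lemma fits_finite:
  assumes "finite F" "F \<subseteq> GV"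
  shows "\<exists>f. fits F eG f"
  using assms
proof (induction F rule: finite_psubset_induct)
  case (psubset F)
  show ?case
  proof (cases "F = {}")
    case True
    then show ?thesis by (simp add: fits_def)
  next
    case False
    define m where "m = Min (level ` F)"
    define T where "T = {p \<in> F. level p = m}"
    define R where "R = F - T"
    have m_le: "m \<le> level p" if "p \<in> F" for p using that psubset.hyps by (simp add: m_def)
    have "m \<in> level ` F" unfolding m_def using False psubset.hyps by (intro Min_in) auto
    then have "R \<subset> F" by (auto simp: R_def T_def)
    moreover from this have R: "R \<subseteq> GV" "finite R" using psubset by (auto intro: finite_subset)
    ultimately obtain fR where fR: "fits R eG fR" using psubset.IH by blast
    have mR: "m < level p" if "p \<in> R" for p
      using m_le[of p] that by (auto simp: R_def T_def)
    have TF: "T \<subseteq> F" "fst ` T \<subseteq> (\<lambda>x. eK x x) ` verts K" "finite (fst ` T)"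
      using psubset by (auto simp: T_def GV_def)
    obtain g h where "g \<in> fst ` T \<rightarrow> verts K" "h \<in> R \<rightarrow> verts K" "inj_on h R"
      "\<forall>l\<in>fst ` T. eK (g l) (g l) = l"
      "\<forall>p\<in>R. eK (h p) (h p) = fst p" "\<forall>l\<in>fst ` T. \<forall>p\<in>R. g l \<noteq> h p"
      "\<forall>p\<in>R. \<forall>q\<in>R. adj eG p q \<longrightarrow> eK (h p) (h q) = eG p q"
      "\<forall>l\<in>fst ` T. \<forall>p\<in>R. src (snd p ! m) = l \<longrightarrow>
         eK (g l) (h p) = fwd (snd p ! m) \<and> eK (h p) (g l) = bwd (snd p ! m)"
      by (rule fits_cone[OF R mR fR TF(2,3)])
    note gh = this(1-3) this(4-8)[rule_format]
    \<comment> \<open>This map may identify vertices of \<open>T\<close>; all other pairs stay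
      distinct.\<close>
    define \<phi> where "\<phi> p = (if p \<in> T then g (fst p) else h p)" for p
    have \<phi>K: "\<phi> p \<in> verts K" if "p \<in> F" for p
      using gh(1,2) that by (auto simp: \<phi>_def R_def)
    have \<phi>d: "eK (\<phi> p) (\<phi> p) = fst p" if "p \<in> F" for p
      using gh(4,5) that by (auto simp: \<phi>_def R_def)
    have \<phi>ne: "\<phi> p \<noteq> \<phi> q" if "p \<in> F" "q \<in> F" "p \<noteq> q" "p \<notin> T \<or> q \<notin> T" for p q
    proof -
      have "h p \<noteq> h q" if "p \<in> R" "q \<in> R" using that gh(3) \<open>p \<noteq> q\<close> by (auto simp: inj_on_def)
      moreover have "g (fst p) \<noteq> h q" if "p \<in> T" "q \<in> R" using gh(6) that by blast
      moreover have "g (fst q) \<noteq> h p" if "q \<in> T" "p \<in> R" using gh(6) that by blast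
      ultimately show ?thesis using that by (auto simp: \<phi>_def R_def)
    qed
    \<comment> \<open>In \<open>e\<close> only vertices of \<open>T\<close> can be nonadjacent and \<open>T\<close> has no edges, so there are no long
      induced cycles.\<close>
    define e where "e p q = (if p = q then fst p else if p \<in> T \<and> q \<in> T then {} else eK (\<phi> p) (\<phi> q))" for p q
    have e_d: "e p p = fst p" for p by (simp add: e_def)
    have e_T: "\<not> adj e p q" if "p \<in> T" "q \<in> T" for p q using that by (simp add: e_def adj_def)
    have e_eq: "e p q = eK (\<phi> p) (\<phi> q)" if "p \<in> F" "q \<in> F" "p = q \<or> p \<notin> T \<or> q \<notin> T" for p q
      using that \<phi>d by (auto simp: e_def)
    have e_adj: "adj e p q" if "p \<in> F" "q \<in> F" "p \<noteq> q" "p \<notin> T \<or> q \<notin> T" for p q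
      using eK_nonempty[OF \<phi>K[OF that(1)] \<phi>K[OF that(2)] \<phi>ne[OF that]] that e_eq[of p q] e_eq[of q p]
      by (auto simp: adj_def)
    have valid: "valid F e"
      unfolding valid_def
    proof (intro ballI)
      fix p q assume pq: "p \<in> F" "q \<in> F"
      have "fst p \<subseteq> L" using \<phi>d[OF pq(1)] eK_valid(1) by metis
      then show "e p q \<subseteq> L \<and> (p \<noteq> q \<longrightarrow> (\<forall>R\<in>e p q. ar R = 2))"
        using eK_valid(1)[of "\<phi> p" "\<phi> q"] eK_valid(2)[of "\<phi> p" "\<phi> q"] \<phi>ne[OF pq] by (auto simp: e_def)
    qed
    have fits_\<phi>: "\<exists>f. fits C e f"
      if C: "C \<subseteq> F" "\<And>p q. p \<in> C \<Longrightarrow> q \<in> C \<Longrightarrow> p = q \<or> p \<notin> T \<or> q \<notin> T" for C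
    proof
      have "inj_on \<phi> C" using C \<phi>ne unfolding inj_on_def by blast
      then show "fits C e \<phi>" using C \<phi>K e_eq unfolding fits_def by (auto simp: subset_iff)
    qed
    obtain f where f: "fits F e f"
    proof (rule completion_exists[of F e])
      show "countable F" using psubset.hyps by (simp add: countable_finite)
      show "valid F e" by (rule valid)
    next
      fix C assume C: "hole L (of_edge ar F e) C"
      have CT: "u \<in> T" if u: "u \<in> C" for u
      proof (rule ccontr)
        assume "u \<notin> T"
        obtain v where "v \<in> C" "u \<noteq> v" "\<not> adjacent L (of_edge ar F e) u v"
          using bspec[OF holeD(4)[OF C] u] by blast
        moreover have "C \<subseteq> F" using holeD(1)[OF C] by simp
        ultimately show False using e_adj[of u v] u \<open>u \<notin> T\<close> by (auto simp: adjacent_valid[OF valid])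
      qed
      obtain u v where "u \<in> C" "v \<in> C" "adjacent L (of_edge ar F e) u v"
        using holeD(3)[OF C] by blast
      then show "\<exists>f. fits C e f" using e_T[of u v] CT by (auto simp: adjacent_valid[OF valid])
    next
      fix p q r assume "p \<in> F" "q \<in> F" "r \<in> F" "adj e p q" "adj e q r" "adj e p r"
      then show "\<exists>f. fits {p, q, r} e f"
        using e_T[of p q] e_T[of q r] e_T[of p r] by (intro fits_\<phi>) auto
    next
      fix p q assume "p \<in> F" "q \<in> F" "p = q \<or> adj e p q"
      then show "\<exists>f. fits {p, q} e f" using e_T[of p q] by (intro fits_\<phi>) auto
    qed
    \<comment> \<open>Every link ends above level \<open>m\<close>, hence outside \<open>T\<close>.
      If it starts in \<open>T\<close>, its label is the letter at position \<open>m\<close>, which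
      the cone has realised.\<close>
    have up: "adj e p q \<and> adj e q p \<and> eG p q = e p q \<and> eG q p = e q p"
      if pq: "p \<in> F" "q \<in> F" and link: "link p q" for p q
    proof -
      have q: "q \<in> R" using m_le[OF pq(1)] link_level[OF link] pq by (auto simp: R_def T_def)
      then have nT: "q \<notin> T" by (simp add: R_def)
      have "eK (\<phi> p) (\<phi> q) = eG p q \<and> eK (\<phi> q) (\<phi> p) = eG q p"
      proof (cases "p \<in> T")
        case True
        then have "level p = m" by (simp add: T_def)
        moreover have "src (snd q ! level p) = fst p" using link by (simp add: link_def)
        ultimately show ?thesis using gh(8)[of "fst p" q] True q nT eG_link[OF link]
          by (simp add: \<phi>_def)
      next
        case False
        then have p: "p \<in> R" using pq by (simp add: R_def)
        have "q \<in> GV" using pq(2) psubset.prems by blast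
        then obtain a b where ab: "a \<in> verts K" "b \<in> verts K" "a \<noteq> b" "snd q ! level p = tp a b"
            "eK b b = fst q"
          by (rule letter_type[OF _ link_level[OF link]])
        then have "adj eG p q" "adj eG q p"
          using eK_nonempty[OF ab(1-3)] eG_link[OF link] by (auto simp: adj_def tp_def)
        then show ?thesis using gh(7) p q False nT by (simp add: \<phi>_def)
      qed
      moreover have "p \<noteq> q" using eG_link(3)[OF link] .
      ultimately show ?thesis
        using e_adj[of p q] e_adj[of q p] e_eq[of p q] e_eq[of q p] pq nT by simp
    qed
    have "fits F eG f"
    proof (rule fits_cong[OF f])
      show "eG p p = e p p" for p by (simp add: eG_diag e_d)
      show "adj e p q \<and> eG p q = e p q" if "p \<in> F" "q \<in> F" "adj eG p q" for p q
        using adj_eG[OF that(3)] up[of p q] up[of q p] that by blast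
    qed
    then show ?thesis by blast
  qed
qed

lemma countable_GV: "countable GV"
proof (rule countable_subset)
  have "fst p \<in> Pow L \<and> snd p \<in> lists types" if "p \<in> GV" for p
    using that unfolding GV_def by (auto dest: subsetD[OF eK_valid(1)])
  then show "GV \<subseteq> Pow L \<times> lists types" unfolding mem_Times_iff[symmetric] by (rule subsetI)
  have "countable (Pow L)" using finite_L by (simp add: countable_finite)
  then show "countable (Pow L \<times> lists types)"
    using countable_lists[OF countable_finite[OF finite_types]] by (rule countable_SIGMA)
qed

text \<open>Holes, triangles and pairs are finite, so \<open>fits_finite\<close> covers everything
  that \<open>completion_exists\<close> asks for.\<close>

lemma fits_GV:
  obtains f where "fits GV eG f"
proof (rule completion_exists[OF countable_GV valid_eG])
  fix C assume C: "hole L (of_edge ar GV eG) C"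
  show "\<exists>f. fits C eG f" using holeD(1,2)[OF C] by (intro fits_finite) simp_all
qed (auto intro: fits_finite)

subsection \<open>Copies of the given structure\<close>

definition vertex :: "nat \<Rightarrow> 'a" where
  "vertex = from_nat_into (verts K)"

definition word :: "'a \<Rightarrow> ('l set \<times> 'l set \<times> 'l set \<times> 'l set) list" where
  "word v = map (\<lambda>i. tp (vertex i) v) [0..<inv_into UNIV vertex v]"

text \<open>The loop type is kept beside the word because the empty word has no letter from which to
  read it.\<close>

definition point :: "(nat \<Rightarrow> nat) \<Rightarrow> 'a \<Rightarrow> 'l set \<times> ('l set \<times> 'l set \<times> 'l set \<times> 'l set) list" where
  "point W v = (eK v v, act W (word v))"

lemma bij_vertex: "bij_betw vertex UNIV (verts K)"
  unfolding vertex_def using countable_K infinite_K by (rule bij_betw_from_nat_into)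

lemma vertex_in: "vertex n \<in> verts K" and vertex_eq: "vertex m = vertex n \<longleftrightarrow> m = n"
  using bij_vertex by (auto simp: bij_betw_def inj_eq)

lemma word_vertex: "word (vertex n) = map (\<lambda>i. tp (vertex i) (vertex n)) [0..<n]"
  using bij_vertex by (simp add: word_def bij_betw_def)

lemma vertex_cases: assumes "v \<in> verts K" obtains n where "v = vertex n"
  using assms bij_vertex unfolding bij_betw_def by blast

lemma word_types: assumes "v \<in> verts K" shows "u \<in> set (word v) \<Longrightarrow> u \<in> types \<and> tgt u = eK v v"
proof -
  obtain n where n: "v = vertex n" using assms by (rule vertex_cases)
  assume "u \<in> set (word v)"
  then obtain i where "i < n" "u = tp (vertex i) (vertex n)" by (auto simp: n word_vertex)
  then show "u \<in> types \<and> tgt u = eK v v"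
    using vertex_in vertex_eq[of i n] unfolding types_def n by (auto simp: tp_def)
qed

lemma point_in: assumes "v \<in> verts K" shows "point W v \<in> GV"
  unfolding GV_def point_def using assms word_types[OF assms] set_act[of W "word v"] by auto

text \<open>The point of \<open>vertex m\<close> has level \<open>first W m\<close>, a position
  where \<open>W\<close> takes the value \<open>m\<close>. The common neighbour needed at a position
  \<open>i\<close> below is \<open>vertex (W i)\<close>.\<close>

lemma link_point:
  assumes W: "rgf W" and mn: "m < n"
  shows "link (point W (vertex m)) (point W (vertex n))"
    "snd (point W (vertex n)) ! level (point W (vertex m)) = tp (vertex m) (vertex n)"
proof -
  have lev: "level (point W (vertex i)) = first W i" for i by (simp add: point_def word_vertex)
  have nth: "snd (point W (vertex j)) ! i = tp (vertex (W i)) (vertex j)" if "i < first W j" for i j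
    using that less_first[OF that] by (simp add: point_def word_vertex nth_act)
  have f: "first W m < first W n" by (rule first_mono[OF W mn])
  show letter: "snd (point W (vertex n)) ! level (point W (vertex m)) = tp (vertex m) (vertex n)"
    using nth[OF f] by (simp add: lev rgf_first W)
  show "link (point W (vertex m)) (point W (vertex n))"
    unfolding link_def letter
  proof (intro conjI allI impI)
    show "level (point W (vertex m)) < level (point W (vertex n))" using f by (simp add: lev)
    show "src (tp (vertex m) (vertex n)) = fst (point W (vertex m))" by (simp add: tp_def point_def)
    fix i assume "i < level (point W (vertex m))"
    then have i: "i < first W m" by (simp add: lev)
    have "W i < m" by (rule less_first[OF i])
    then show "\<exists>a\<in>verts K. \<exists>b\<in>verts K. \<exists>c\<in>verts K. a \<noteq> b \<and> a \<noteq> c \<and> b \<noteq> c \<and>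
       tp a b = snd (point W (vertex m)) ! i \<and> tp a c = snd (point W (vertex n)) ! i \<and>
       tp b c = tp (vertex m) (vertex n)"
      using nth[OF i] nth[of i n] i f mn
      by (intro bexI[of _ "vertex (W i)"] bexI[of _ "vertex m"] bexI[of _ "vertex n"])
        (auto simp: vertex_eq vertex_in)
  qed
qed

text \<open>Any two points are linked with the label that their vertices have in \<open>K\<close>.
  As \<open>K\<close> is irreducible, these labels are nonempty, so \<open>\<phi>\<close> has to
  respect all of them.\<close>

lemma embedding_point:
  assumes W: "rgf W" and \<phi>: "fits GV eG \<phi>"
  shows "embedding L (\<phi> \<circ> point W) K K"
proof -
  let ?f = "\<phi> \<circ> point W"
  have in_K: "?f v \<in> verts K" if "v \<in> verts K" for v
    using \<phi> point_in[OF that] by (auto simp: fits_def)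
  have lt: "?f (vertex m) \<noteq> ?f (vertex n) \<and> eK (?f (vertex m)) (?f (vertex n)) = eK (vertex m) (vertex n) \<and>
      eK (?f (vertex n)) (?f (vertex m)) = eK (vertex n) (vertex m)" if mn: "m < n" for m n
  proof -
    let ?p = "point W (vertex m)" and ?q = "point W (vertex n)"
    have pq: "?p \<in> GV" "?q \<in> GV" using vertex_in by (auto intro: point_in)
    note link = link_point[OF W mn]
    have e: "eG ?p ?q = eK (vertex m) (vertex n)" "eG ?q ?p = eK (vertex n) (vertex m)" "?p \<noteq> ?q"
      using eG_link[OF link(1)] unfolding link(2) by (simp_all add: tp_def)
    have "adj eG ?p ?q" "adj eG ?q ?p"
      using e eK_nonempty[OF vertex_in[of m] vertex_in[of n]] mn by (auto simp: adj_def vertex_eq)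
    then have "eK (?f (vertex m)) (?f (vertex n)) = eK (vertex m) (vertex n)"
        "eK (?f (vertex n)) (?f (vertex m)) = eK (vertex n) (vertex m)"
      using \<phi> pq e(1,2) unfolding fits_def by simp_all
    moreover have "\<phi> ?p \<noteq> \<phi> ?q" using \<phi> pq e(3) unfolding fits_def by (meson inj_onD)
    ultimately show ?thesis by simp
  qed
  have diag: "eK (?f v) (?f v) = eK v v" if "v \<in> verts K" for v
    using \<phi> point_in[OF that] unfolding fits_def by (simp add: eG_diag) (simp add: point_def)
  have "eK (?f u) (?f v) = eK u v \<and> (?f u = ?f v \<longrightarrow> u = v)" if uv: "u \<in> verts K" "v \<in> verts K" for u v
  proof -
    obtain m where m: "u = vertex m" using uv(1) by (rule vertex_cases)
    obtain n where n: "v = vertex n" using uv(2) by (rule vertex_cases)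
    consider "m < n" | "m = n" | "n < m" by linarith
    then show ?thesis
    proof cases
      case 2
      then show ?thesis using diag[OF uv(1)] m n by simp
    next
      case 3
      then show ?thesis using lt[OF 3] unfolding m n by metis
    qed (use lt[of m n] m n in simp)
  qed
  then show ?thesis
    unfolding embedding_iff_edge[OF K K arity] using in_K by (auto simp: eK_def inj_on_def)
qed

text \<open>The bound counts the families \<open>t\<close> of short words indexed by
  \<open>S\<close>. A copy in the image of \<open>K\<close> is determined by an envelope together
  with such a \<open>t\<close>, and the dual Ramsey theorem removes the dependence on the
  envelope.\<close>

lemma ramsey_bound_finite:
  assumes S: "S \<subseteq> verts K" "finite S"
  shows "\<exists>l::nat. ramsey_bound L (induced_sub K S) K (enat l)"
proof -
  obtain \<phi> where \<phi>: "fits GV eG \<phi>" by (rule fits_GV)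
  let ?A = "induced_sub K S"
  define N where "N = card (S \<rightarrow>\<^sub>E insert None (Some ` types))"
  define TT where "TT = S \<rightarrow>\<^sub>E {l. set l \<subseteq> types \<and> length l \<le> N}"
  have TT: "finite TT"
    unfolding TT_def using S(2) finite_types by (intro finite_PiE finite_lists_length_le)
  have A: "L_structure L ar ?A" by (rule L_structure_induced_sub[OF K])
  have "ramsey_bound L ?A K (enat (card TT))"
    unfolding ramsey_bound_def
  proof (intro allI impI)
    fix r :: nat and \<chi> assume \<chi>: "\<chi> \<in> Embs L K ?A \<rightarrow> {..<r}"
    \<comment> \<open>Embeddings preserve loop types, so \<open>eK a a\<close> is the loop type of
      the image of \<open>a\<close>.\<close>
    define em where "em V t = restrict (\<lambda>a. \<phi> (eK a a, subst (t a) V)) S" for V t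
    \<comment> \<open>The colour of \<open>V\<close> is the whole family of colours of its copies; 0
      is a default for those \<open>t\<close> that give no embedding.\<close>
    define c where "c V = restrict (\<lambda>t. if em V t \<in> Embs L K ?A then \<chi> (em V t) else 0) TT" for V
    have "c ` {V. frgf N V} \<subseteq> TT \<rightarrow>\<^sub>E insert 0 {..<r}" using \<chi> by (auto simp: c_def)
    then have "finite (c ` {V. frgf N V})"
      using TT by (elim finite_subset) (intro finite_PiE, auto)
    then obtain W \<kappa> where W: "rgf W" and \<kappa>: "\<And>V. frgf N V \<Longrightarrow> c (act W V) = \<kappa>"
      using dual_ramsey[of c N] by metis
    let ?f = "\<phi> \<circ> point W"
    have f: "embedding L ?f K K" by (rule embedding_point[OF W \<phi>])
    then have fk: "eK (?f v) (?f v) = eK v v" if "v \<in> verts K" for v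
      using that unfolding embedding_iff_edge[OF K K arity] by (simp add: eK_def)
    let ?B = "induced_sub K (?f ` verts K)"
    have B: "L_structure L ar ?B" by (rule L_structure_induced_sub[OF K])
    have "\<chi> ` Embs L ?B ?A \<subseteq> \<kappa> ` TT"
    proof
      fix y assume "y \<in> \<chi> ` Embs L ?B ?A"
      then obtain e' where e': "e' \<in> extensional S" "embedding L e' ?A ?B" "y = \<chi> e'"
        by (auto simp: Embs_def)
      have e'B: "e' a \<in> ?f ` verts K" if "a \<in> S" for a
        using e'(2) that by (auto simp: embedding_def)
      have f_sub: "?f ` verts K \<subseteq> verts K" using f by (auto simp: embedding_def)
      have e'k: "eK (e' a) (e' b) = eK a b" if "a \<in> S" "b \<in> S" for a b
      proof -
        have "edge L ar ?B (e' a) (e' b) = edge L ar ?A a b"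
          using e'(2) that unfolding embedding_iff_edge[OF A B arity] verts_induced_sub by blast
        then show ?thesis
          unfolding eK_def edge_induced_sub[OF e'B[OF that(1)] e'B[OF that(2)]]
            edge_induced_sub[OF that] .
      qed
      have "e' \<in> Embs L K ?A"
      proof -
        have "e' \<in> S \<rightarrow> verts K" using e'B f_sub by blast
        moreover have "inj_on e' S" using e'(2) by (simp add: embedding_def)
        ultimately have "embedding L e' ?A K"
          unfolding embedding_iff_edge[OF A K arity] using e'k by (simp add: edge_induced_sub eK_def)
        then show ?thesis using e'(1) by (simp add: Embs_def)
      qed
      \<comment> \<open>The envelope is taken for the words of the preimages \<open>e a\<close> in
        \<open>K\<close>; \<open>act W\<close> then carries it to an envelope of the copy
        \<open>e'\<close>.\<close>
      define e where "e a = inv_into (verts K) ?f (e' a)" for a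
      have e: "e a \<in> verts K" "?f (e a) = e' a" if "a \<in> S" for a
        using e'B[OF that] by (simp_all add: e_def inv_into_into f_inv_into_f del: o_apply)
      have ek: "eK (e a) (e a) = eK a a" if "a \<in> S" for a
        using fk[OF e(1)[OF that]] e(2)[OF that] e'k[OF that that] by simp
      have "\<exists>V t. frgf N V \<and> (\<forall>a\<in>S. set (t a) \<subseteq> types \<and> length (t a) \<le> N \<and> word (e a) = subst (t a) V)"
      proof (rule envelope_exists[OF S(2) finite_types _ N_def])
        show "word (e a) \<in> lists types" if "a \<in> S" for a
          unfolding in_lists_conv_set using word_types[OF e(1)[OF that]] by blast
      qed
      then obtain V t where V: "frgf N V"
        and t: "\<And>a. a \<in> S \<Longrightarrow> set (t a) \<subseteq> types \<and> length (t a) \<le> N \<and> word (e a) = subst (t a) V" by blast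
      define t' where "t' = restrict t S"
      have t': "t' \<in> TT" using t by (auto simp: t'_def TT_def)
      have "em (act W V) t' = e'"
      proof (rule extensionalityI[of _ S])
        fix a assume a: "a \<in> S"
        have "em (act W V) t' a = \<phi> (eK (e a) (e a), act W (word (e a)))"
          using a t[OF a] by (simp add: em_def t'_def act_subst[OF W] ek)
        also have "\<dots> = e' a" using e(2)[OF a] by (simp add: point_def)
        finally show "em (act W V) t' a = e' a" .
      qed (use e'(1) in \<open>auto simp: em_def\<close>)
      then have "y = c (act W V) t'" using \<open>e' \<in> Embs L K ?A\<close> e'(3) t' by (simp add: c_def)
      then show "y \<in> \<kappa> ` TT" using \<kappa>[OF V] t' by simp
    qed
    then have "card (\<chi> ` Embs L ?B ?A) \<le> card TT"
      using TT by (meson card_image_le card_mono finite_imageI le_trans)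
    then show "\<exists>f. embedding L f K K \<and>
        enat (card (\<chi> ` Embs L (induced_sub K (f ` verts K)) ?A)) \<le> enat (card TT)"
      using f by (intro exI[of _ ?f]) simp
  qed
  then show ?thesis ..
qed

end

theorem theorem1:
  fixes L :: "'l set" and ar :: "'l \<Rightarrow> nat" and K :: "('a, 'l) struct"
  assumes "finite L"
    and "\<forall>R\<in>L. ar R = 1 \<or> ar R = 2"
    and "L_structure L ar K"
    and "countable (verts K)" and "infinite (verts K)"
    and "irreducible_struct L K"
    and "\<And>A :: (nat, 'l) struct.
           L_structure L ar A \<Longrightarrow>
           countable (verts A) \<Longrightarrow>
           (\<And>vs. induced_cycle L A vs \<Longrightarrow> has_completion L (induced_sub A (set vs)) K) \<Longrightarrow>
           (\<And>S. S \<subseteq> verts A \<Longrightarrow> finite S \<Longrightarrow> card S \<le> 2 \<Longrightarrow>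
                 irreducible_struct L (induced_sub A S) \<Longrightarrow> embeds L (induced_sub A S) K) \<Longrightarrow>
           has_completion L A K"
  shows "finite_big_ramsey_degrees L K"
proof -
  interpret cycle_completion L ar K
    using assms by (rule cycle_completion.intro)
  have "big_ramsey_degree L (induced_sub K S) K < \<infinity>" if S: "S \<subseteq> verts K" "finite S" for S
  proof -
    obtain l :: nat where "ramsey_bound L (induced_sub K S) K (enat l)"
      using ramsey_bound_finite[OF S] by blast
    then have "big_ramsey_degree L (induced_sub K S) K \<le> enat l"
      unfolding big_ramsey_degree_def by (rule Least_le)
    also have "\<dots> < \<infinity>" by simp
    finally show ?thesis .
  qed
  then show ?thesis by (simp add: finite_big_ramsey_degrees_def)
qed

end
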